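(* There exist sequences $(\lambda_n^+)_{n\ge0}$ and $(\lambda_n^-)_{n\ge0}$ in $\sigma(A)$ and a constant $C>0$ such that $\operatorname{Im}\lambda_n^\pm\sim\pm n\pi$ as $n\to\infty$ and $$-\frac{C}{|\operatorname{Im}\lambda_n^\pm|^{1/2}}\le\operatorname{Re}\lambda_n^\pm<0,\quad n\ge0.$$ In particular, $$\limsup_{|s|\to\infty}|s|^{-1/2}\|R(is,A)\|>0,$$ where $s$ ranges over $\mathbb{R}$.
   Context: All function spaces are complex. Let $X=H^1(-1,0)\times L^2(-1,0)\times L^2(0,1)$ and $Y=H^2(-1,0)\times H^1(-1,0)\times H^2(0,1)$, both with their natural Hilbert space norms. Let $A$ be the closed, densely defined operator on $X$ given by $Ax=(v,u'',w'')$ for $x=(u,v,w)$ in the domain $$D(A)=\{(u,v,w)\in Y: u'(-1)=w(1)=0,\ v(0)=w(0),\ u'(0)=w'(0)\}.$$ $\sigma(A)$ denotes the spectrum of $A$. It satisfies $\sigma(A)\cap i\mathbb{R}=\{0\}$, so the resolvent operator $R(is,A)=(is-A)^{-1}$ exists for all $s\in\mathbb{R}\setminus\{0\}$. The norm $\|R(is,A)\|$ is the operator norm on $X$. The notation $a_n\sim b_n$ as $n\to\infty$ means $a_n/b_n\to1$. *)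

theory Defs
  imports "HOL-Analysis.Analysis" "HOL-Library.Landau_Symbols"
begin

section \<open>\<open>L\<^sup>2(a,b)\<close> as a space of almost-everywhere classes\<close>

definition ae_class :: "real \<Rightarrow> real \<Rightarrow> (real \<Rightarrow> complex) \<Rightarrow> (real \<Rightarrow> complex) set" where
  "ae_class a b f = {g. AE x in lebesgue_on {a<..<b}. g x = f x}"

definition square_integrable :: "real \<Rightarrow> real \<Rightarrow> (real \<Rightarrow> complex) \<Rightarrow> bool" where
  "square_integrable a b f \<longleftrightarrow>
     f \<in> borel_measurable (lebesgue_on {a<..<b}) \<and>
     integrable (lebesgue_on {a<..<b}) (\<lambda>x. (norm (f x))\<^sup>2)"

definition L2 :: "real \<Rightarrow> real \<Rightarrow> (real \<Rightarrow> complex) set set" where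
  "L2 a b = ae_class a b ` {f. square_integrable a b f}"

definition L2_norm :: "real \<Rightarrow> real \<Rightarrow> (real \<Rightarrow> complex) set \<Rightarrow> real" where
  "L2_norm a b F =
     sqrt (LINT x|lebesgue_on {a<..<b}. (norm ((SOME f. f \<in> F) x))\<^sup>2)"

text \<open>The class of \<open>c f - g\<close>, formed elementwise. For two a.e. classes over the same interval
  this set is again a full a.e. class, also when \<open>c = 0\<close>; see the lemma below.\<close>

definition scale_diff ::
    "complex \<Rightarrow> (real \<Rightarrow> complex) set \<Rightarrow> (real \<Rightarrow> complex) set \<Rightarrow> (real \<Rightarrow> complex) set" where
  "scale_diff c F G = {(\<lambda>x. c * f x - g x) | f g. f \<in> F \<and> g \<in> G}"

lemma scale_diff_ae_class:
  "scale_diff c (ae_class a b f) (ae_class a b g) = ae_class a b (\<lambda>x. c * f x - g x)"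
proof (intro equalityI subsetI)
  fix h assume "h \<in> scale_diff c (ae_class a b f) (ae_class a b g)"
  then obtain f' g' where h: "h = (\<lambda>x. c * f' x - g' x)"
    and "AE x in lebesgue_on {a<..<b}. f' x = f x" "AE x in lebesgue_on {a<..<b}. g' x = g x"
    by (auto simp: scale_diff_def ae_class_def)
  then have "AE x in lebesgue_on {a<..<b}. h x = c * f x - g x"
    by (auto elim: AE_mp)
  then show "h \<in> ae_class a b (\<lambda>x. c * f x - g x)"
    by (simp add: ae_class_def)
next
  fix h assume h: "h \<in> ae_class a b (\<lambda>x. c * f x - g x)"
  have "f \<in> ae_class a b f"
    by (simp add: ae_class_def)
  moreover have "(\<lambda>x. c * f x - h x) \<in> ae_class a b g"
    using h by (auto simp: ae_class_def elim!: AE_mp)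
  moreover have "h = (\<lambda>x. c * f x - (\<lambda>x. c * f x - h x) x)"
    by simp
  ultimately show "h \<in> scale_diff c (ae_class a b f) (ae_class a b g)"
    unfolding scale_diff_def mem_Collect_eq by (intro exI conjI)
qed


section \<open>Sobolev spaces on a bounded interval\<close>

text \<open>\<open>test_function a b \<phi> \<phi>'\<close>: the function \<open>\<phi>\<close> is in \<open>C\<^sub>c\<^sup>1(a,b)\<close> and has derivative \<open>\<phi>'\<close>.
  As in Brezis' book, test functions in the definition of the weak derivative are \<open>C\<^sup>1\<close>; this gives
  the same weak derivatives as smooth test functions.\<close>

definition test_function ::
    "real \<Rightarrow> real \<Rightarrow> (real \<Rightarrow> complex) \<Rightarrow> (real \<Rightarrow> complex) \<Rightarrow> bool" where
  "test_function a b \<phi> \<phi>' \<longleftrightarrow>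
     (\<forall>x. (\<phi> has_vector_derivative \<phi>' x) (at x)) \<and> continuous_on UNIV \<phi>' \<and>
     closure {x. \<phi> x \<noteq> 0} \<subseteq> {a<..<b}"

definition has_weak_derivative ::
    "real \<Rightarrow> real \<Rightarrow> (real \<Rightarrow> complex) set \<Rightarrow> (real \<Rightarrow> complex) set \<Rightarrow> bool" where
  "has_weak_derivative a b F G \<longleftrightarrow>
     (\<forall>f\<in>F. \<forall>g\<in>G. \<forall>\<phi> \<phi>'. test_function a b \<phi> \<phi>' \<longrightarrow>
        (LINT x|lebesgue_on {a<..<b}. f x * \<phi>' x) =
        - (LINT x|lebesgue_on {a<..<b}. g x * \<phi> x))"

definition weak_deriv :: "real \<Rightarrow> real \<Rightarrow> (real \<Rightarrow> complex) set \<Rightarrow> (real \<Rightarrow> complex) set" where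
  "weak_deriv a b F = (THE G. G \<in> L2 a b \<and> has_weak_derivative a b F G)"

definition H1 :: "real \<Rightarrow> real \<Rightarrow> (real \<Rightarrow> complex) set set" where
  "H1 a b = {F \<in> L2 a b. \<exists>G\<in>L2 a b. has_weak_derivative a b F G}"

definition H2 :: "real \<Rightarrow> real \<Rightarrow> (real \<Rightarrow> complex) set set" where
  "H2 a b = {F \<in> H1 a b. weak_deriv a b F \<in> H1 a b}"

definition H1_norm :: "real \<Rightarrow> real \<Rightarrow> (real \<Rightarrow> complex) set \<Rightarrow> real" where
  "H1_norm a b F = sqrt ((L2_norm a b F)\<^sup>2 + (L2_norm a b (weak_deriv a b F))\<^sup>2)"

text \<open>Value at a point \<open>t\<close> of \<open>[a,b]\<close>, end points included, of the representative that is continuous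
  on \<open>[a,b]\<close>; it exists for elements of \<open>H\<^sup>1(a,b)\<close>.\<close>

definition point_value :: "real \<Rightarrow> real \<Rightarrow> (real \<Rightarrow> complex) set \<Rightarrow> real \<Rightarrow> complex" where
  "point_value a b F t = (THE c. \<exists>f\<in>F. continuous_on {a..b} f \<and> f t = c)"


section \<open>The operator\<close>

type_synonym state = "(real \<Rightarrow> complex) set \<times> (real \<Rightarrow> complex) set \<times> (real \<Rightarrow> complex) set"

definition X_space :: "state set" where
  "X_space = H1 (-1) 0 \<times> L2 (-1) 0 \<times> L2 0 1"

fun X_norm :: "state \<Rightarrow> real" where
  "X_norm (u, v, w) = sqrt ((H1_norm (-1) 0 u)\<^sup>2 + (L2_norm (-1) 0 v)\<^sup>2 + (L2_norm 0 1 w)\<^sup>2)"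

definition Y_space :: "state set" where
  "Y_space = H2 (-1) 0 \<times> H1 (-1) 0 \<times> H2 0 1"

definition A_dom :: "state set" where
  "A_dom = {(u, v, w) \<in> Y_space.
     point_value (-1) 0 (weak_deriv (-1) 0 u) (-1) = 0 \<and>
     point_value 0 1 w 1 = 0 \<and>
     point_value (-1) 0 v 0 = point_value 0 1 w 0 \<and>
     point_value (-1) 0 (weak_deriv (-1) 0 u) 0 = point_value 0 1 (weak_deriv 0 1 w) 0}"

fun A_op :: "state \<Rightarrow> state" where
  "A_op (u, v, w) =
     (v, weak_deriv (-1) 0 (weak_deriv (-1) 0 u), weak_deriv 0 1 (weak_deriv 0 1 w))"

fun state_scale_diff :: "complex \<Rightarrow> state \<Rightarrow> state \<Rightarrow> state" where
  "state_scale_diff c (u, v, w) (u', v', w') =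
     (scale_diff c u u', scale_diff c v v', scale_diff c w w')"

definition z_minus_A :: "complex \<Rightarrow> state \<Rightarrow> state" where
  "z_minus_A z x = state_scale_diff z x (A_op x)"

definition resolvent :: "complex \<Rightarrow> state \<Rightarrow> state" where
  "resolvent z = inv_into A_dom (z_minus_A z)"

definition resolvent_set :: "complex set" where
  "resolvent_set = {z. bij_betw (z_minus_A z) A_dom X_space \<and>
     (\<exists>K. \<forall>y\<in>X_space. X_norm (resolvent z y) \<le> K * X_norm y)}"

definition spectrum_A :: "complex set" where
  "spectrum_A = - resolvent_set"

text \<open>Operator norm on \<open>X\<close>, as an extended real. On \<open>resolvent_set\<close>, which contains all
  \<open>i s\<close> with \<open>s \<noteq> 0\<close> real, it is finite and is the usual norm.\<close>

definition resolvent_norm :: "complex \<Rightarrow> ereal" where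
  "resolvent_norm z = (SUP y\<in>{y \<in> X_space. X_norm y \<le> 1}. ereal (X_norm (resolvent z y)))"

end

theory Submission
  imports Defs
begin

text \<open>
  An eigenvector for \<open>l = m\<^sup>2 \<noteq> 0\<close> has \<open>v = l u\<close>, \<open>u'' = l\<^sup>2 u\<close> and \<open>w'' = l w\<close>. The outer boundary
  conditions make \<open>u\<close> a multiple of \<open>cosh (l (x + 1))\<close> and \<open>w\<close> a multiple of \<open>sinh (m (1 - x))\<close>. The two
  conditions at the interface then admit a nonzero solution if and only if
  \<open>m cosh m cosh l + sinh m sinh l = 0\<close>, which after division by
  \<open>m cosh m sinh l\<close> reads \<open>coth l = - tanh m / m\<close>. Near the imaginary axis the right-hand side is of
  size \<open>\<bar>l\<bar> powr (-1/2)\<close>, so roots are to be expected within that distance of the large zeros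
  \<open>i (k + 1/2) \<pi>\<close> of \<open>cosh\<close>. Brouwer's fixed point theorem produces them, and since \<open>tanh m / m\<close> has
  positive real part there, they lie in the open left half-plane
  (\<open>characteristic_root_exists\<close>). The equation is real, so the conjugate numbers are roots as well.

  For the resolvent, let \<open>x\<close> be an eigenvector for such an \<open>l\<close> and \<open>s = Im l\<close>. Then
  \<open>(i s - A) x = - (Re l) x\<close>, which forces \<open>\<parallel>R(i s, A)\<parallel> \<ge> 1 / \<bar>Re l\<bar>\<close>, and this is at least a constant times
  \<open>\<bar>s\<bar> powr (1/2)\<close> (\<open>resolvent_norm_ge\<close>). As the resolvent is defined through a choice of preimages, one has to know
  that \<open>x\<close> is the only preimage of \<open>- (Re l) x\<close> in the domain (\<open>preimage_of_mode_unique\<close>). That rests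
  on the description of the weak solutions of \<open>f'' = m\<^sup>2 f\<close> as combinations of exponentials
  (\<open>weak_derivative_fun_second_order\<close>), deduced from the du Bois-Reymond lemma,
  and on the absence of large characteristic roots on the imaginary axis
  (\<open>characteristic_nonzero_imaginary_axis\<close>).
\<close>

section \<open>Test functions and the du Bois-Reymond lemma\<close>

lemma DERIV_max_0_power2: "((\<lambda>x. (max 0 x)\<^sup>2) has_real_derivative 2 * max 0 x) (at (x::real))"
proof (cases x "0::real" rule: linorder_cases)
  case less
  have "((\<lambda>x. 0) has_real_derivative 2 * max 0 x) (at x)"
    using less by (auto intro!: derivative_eq_intros)
  then show ?thesis
    by (rule has_field_derivative_transform_within[where d = "-x"]) (use less in \<open>auto simp: dist_real_def\<close>)
next
  case equal
  have "(\<lambda>h::real. (max 0 h)\<^sup>2 / h) \<midarrow>0\<rightarrow> 0"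
  proof (rule Lim_null_comparison[of _ "\<lambda>h. \<bar>h\<bar>"])
    show "\<forall>\<^sub>F h in at 0. norm ((max 0 h)\<^sup>2 / h) \<le> \<bar>h::real\<bar>"
      by (rule always_eventually) (auto simp: max_def power2_eq_square)
    show "(\<lambda>h::real. \<bar>h\<bar>) \<midarrow>0\<rightarrow> 0" by (auto intro!: tendsto_eq_intros)
  qed
  then show ?thesis using equal by (simp add: DERIV_def)
next
  case greater
  have "((\<lambda>x. x\<^sup>2) has_real_derivative 2 * max 0 x) (at x)"
    using greater by (auto intro!: derivative_eq_intros)
  then show ?thesis
    by (rule has_field_derivative_transform_within[where d = "x"]) (use greater in \<open>auto simp: dist_real_def\<close>)
qed

text \<open>The positive part of the parabola \<open>(x - c) (d - x)\<close> is squared because the square of the positive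
part is of class \<open>C\<^sup>1\<close>, as test functions have to be, whereas the positive part has corners.\<close>

definition parabola_bump :: "real \<Rightarrow> real \<Rightarrow> real \<Rightarrow> real" where
  "parabola_bump c d x = (max 0 ((x - c) * (d - x)))\<^sup>2"

lemma DERIV_parabola_bump:
  "(parabola_bump c d has_real_derivative 2 * max 0 ((x - c) * (d - x)) * (c + d - 2 * x)) (at x)"
proof -
  have "((\<lambda>x. (x - c) * (d - x)) has_real_derivative (c + d - 2 * x)) (at x)"
    by (auto intro!: derivative_eq_intros)
  from DERIV_chain2[OF DERIV_max_0_power2 this] show ?thesis
    unfolding parabola_bump_def .
qed

lemma parabola_bump_nonneg: "0 \<le> parabola_bump c d x"
  by (simp add: parabola_bump_def)

lemma parabola_bump_eq_0_iff:
  assumes "c < d" shows "parabola_bump c d x = 0 \<longleftrightarrow> x \<notin> {c<..<d}"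
proof -
  have "parabola_bump c d x = 0 \<longleftrightarrow> (x - c) * (d - x) \<le> 0"
    by (simp add: parabola_bump_def max_def)
  also have "\<dots> \<longleftrightarrow> x \<notin> {c<..<d}"
    using assms by (auto simp: mult_le_0_iff)
  finally show ?thesis .
qed

lemma continuous_parabola_bump [continuous_intros]: "continuous_on S (parabola_bump c d)"
  unfolding parabola_bump_def by (intro continuous_intros)

lemma test_function_of_real:
  fixes \<phi> :: "real \<Rightarrow> real"
  assumes "\<And>x. (\<phi> has_real_derivative \<phi>' x) (at x)" "continuous_on UNIV \<phi>'"
    and "a < c" "d < b" "\<And>x. x \<notin> {c..d} \<Longrightarrow> \<phi> x = 0"
  shows "test_function a b (\<lambda>x. of_real (\<phi> x)) (\<lambda>x. of_real (\<phi>' x))"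
proof -
  have "closure {x. complex_of_real (\<phi> x) \<noteq> 0} \<subseteq> {c..d}"
    using assms(5) by (intro closure_minimal) (auto, meson+)
  moreover have "((\<lambda>x. complex_of_real (\<phi> x)) has_vector_derivative of_real (\<phi>' x)) (at x)" for x
    using assms(1)[of x] by (intro has_vector_derivative_of_real)
  ultimately show ?thesis
    using assms unfolding test_function_def by (auto intro!: continuous_intros)
qed

text \<open>With \<open>P\<close> the bump on \<open>[c,d]\<close>, the functions \<open>n P / (1 + n P)\<close> stay between 0 and 1, keep the support
of \<open>P\<close>, and converge to the indicator of \<open>(c,d)\<close>. This is how intervals are reached by test functions.\<close>

lemma test_function_plateau:
  assumes "a < c" "c < d" "d < b"
  shows "\<exists>\<phi>'. test_function a b (\<lambda>x. of_real (real n * parabola_bump c d x / (1 + real n * parabola_bump c d x))) \<phi>'"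
proof -
  have ne: "1 + real n * parabola_bump c d x \<noteq> 0" for x
    using parabola_bump_nonneg[of c d x] by (metis add_nonneg_eq_0_iff mult_nonneg_nonneg of_nat_0_le_iff zero_le_one zero_neq_one)
  let ?P = "\<lambda>x. 2 * max 0 ((x - c) * (d - x)) * (c + d - 2 * x)"
  have "test_function a b (\<lambda>x. of_real (real n * parabola_bump c d x / (1 + real n * parabola_bump c d x)))
    (\<lambda>x. of_real (real n * ?P x / (1 + real n * parabola_bump c d x)\<^sup>2))"
  proof (rule test_function_of_real)
    show "((\<lambda>x. real n * parabola_bump c d x / (1 + real n * parabola_bump c d x))
       has_real_derivative real n * ?P x / (1 + real n * parabola_bump c d x)\<^sup>2) (at x)" for x
      apply (rule derivative_eq_intros DERIV_parabola_bump refl ne)+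
      using ne[of x] by (simp add: field_simps power2_eq_square)
    show "continuous_on UNIV (\<lambda>x. real n * ?P x / (1 + real n * parabola_bump c d x)\<^sup>2)"
      using ne by (intro continuous_intros) auto
    show "real n * parabola_bump c d x / (1 + real n * parabola_bump c d x) = 0" if "x \<notin> {c..d}" for x
      using that parabola_bump_eq_0_iff[OF \<open>c < d\<close>, of x] by auto
  qed (use assms in auto)
  then show ?thesis by blast
qed

lemma plateau_tendsto_indicator:
  assumes "c < d"
  shows "(\<lambda>n. real n * parabola_bump c d x / (1 + real n * parabola_bump c d x)) \<longlonglongrightarrow> indicator {c<..<d} x"
proof (cases "x \<in> {c<..<d}")
  case True
  then have "0 < parabola_bump c d x"
    using parabola_bump_eq_0_iff[OF assms, of x] parabola_bump_nonneg[of c d x] by linarith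
  then have "filterlim (\<lambda>n. 1 + real n * parabola_bump c d x) at_top sequentially"
    by (intro filterlim_tendsto_add_at_top[OF tendsto_const] filterlim_at_top_mult_tendsto_pos[OF tendsto_const] filterlim_real_sequentially)
  from tendsto_diff[OF tendsto_const[of 1] tendsto_inverse_0_at_top[OF this]]
  have "(\<lambda>n. 1 - inverse (1 + real n * parabola_bump c d x)) \<longlonglongrightarrow> 1" by simp
  moreover have "1 - inverse (1 + real n * parabola_bump c d x) = real n * parabola_bump c d x / (1 + real n * parabola_bump c d x)" for n
  proof -
    have "1 + real n * parabola_bump c d x > 0"
      using \<open>0 < parabola_bump c d x\<close> by (smt (verit) mult_nonneg_nonneg of_nat_0_le_iff)
    then show ?thesis by (simp add: field_simps)
  qed
  ultimately show ?thesis using True by simp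
next
  case False
  then show ?thesis using parabola_bump_eq_0_iff[OF assms, of x] by simp
qed

text \<open>Plateau functions and dominated convergence show that \<open>f\<close> has integral zero over every subinterval.
At almost every point, \<open>f\<close> is the limit of its averages over shrinking intervals, hence zero.\<close>

lemma du_Bois_Reymond:
  assumes f: "integrable (lebesgue_on {a<..<b}) f"
    and ortho: "\<And>\<phi> \<phi>'. test_function a b \<phi> \<phi>' \<Longrightarrow> (LINT x|lebesgue_on {a<..<b}. f x * \<phi> x) = 0"
  shows "AE x in lebesgue_on {a<..<b}. f x = 0"
proof -
  let ?M = "lebesgue_on {a<..<b}"
  define F where "F = (\<lambda>x. if x \<in> {a<..<b} then f x else 0)"
  have meas [measurable]: "f \<in> borel_measurable ?M" using f by simp
  have zero: "integral (cbox c d) F = 0" if cd: "a < c" "c < d" "d < b" for c d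
  proof -
    define \<phi> where "\<phi> = (\<lambda>n x. real n * parabola_bump c d x / (1 + real n * parabola_bump c d x))"
    have bound: "\<bar>\<phi> n x\<bar> \<le> 1" for n x
      using parabola_bump_nonneg[of c d x] unfolding \<phi>_def
      by (smt (verit) divide_le_eq_1 divide_nonneg_nonneg mult_nonneg_nonneg of_nat_0_le_iff)
    have ne: "1 + real n * parabola_bump c d x \<noteq> 0" for x n
      using parabola_bump_nonneg[of c d x] by (metis add_nonneg_eq_0_iff mult_nonneg_nonneg of_nat_0_le_iff zero_le_one zero_neq_one)
    have [measurable]: "\<phi> n \<in> borel_measurable ?M" for n
    proof -
      have "continuous_on UNIV (\<phi> n)"
        unfolding \<phi>_def using ne by (intro continuous_intros) auto
      then have "\<phi> n \<in> borel_measurable lebesgue"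
        using continuous_imp_measurable_on_sets_lebesgue[of UNIV "\<phi> n"] by (simp add: lebesgue_on_UNIV_eq)
      then show ?thesis by (rule measurable_restrict_space1)
    qed
    have "(\<lambda>n. LINT x|?M. f x * of_real (\<phi> n x)) \<longlonglongrightarrow> (LINT x|?M. f x * of_real (indicator {c<..<d} x))"
    proof (rule integral_dominated_convergence[where w = "\<lambda>x. norm (f x)"])
      have "{c<..<d} \<in> sets ?M"
        using cd by (simp add: sets_restrict_space_iff greaterThanLessThan_subseteq_greaterThanLessThan)
      then show "(\<lambda>x. f x * of_real (indicator {c<..<d} x)) \<in> borel_measurable ?M"
        by measurable
      show "AE x in ?M. (\<lambda>n. f x * of_real (\<phi> n x)) \<longlonglongrightarrow> f x * of_real (indicator {c<..<d} x)"
        unfolding \<phi>_def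
        by (intro AE_I2 tendsto_mult tendsto_const tendsto_of_real plateau_tendsto_indicator cd)
      show "AE x in ?M. norm (f x * of_real (\<phi> n x)) \<le> norm (f x)" for n
        using bound by (auto simp: norm_mult intro!: mult_left_le)
    qed (use f in auto)
    moreover have "(LINT x|?M. f x * of_real (\<phi> n x)) = 0" for n
      using test_function_plateau[OF cd, of n] ortho unfolding \<phi>_def by blast
    ultimately have z: "(LINT x|?M. f x * of_real (indicator {c<..<d} x)) = 0"
      by (simp add: LIMSEQ_const_iff)
    have int: "integrable ?M (\<lambda>x. f x * of_real (indicator {c<..<d} x))"
    proof (rule Bochner_Integration.integrable_bound[OF f])
      have "{c<..<d} \<in> sets ?M"
        using cd by (simp add: sets_restrict_space_iff greaterThanLessThan_subseteq_greaterThanLessThan)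
      then show "(\<lambda>x. f x * of_real (indicator {c<..<d} x)) \<in> borel_measurable ?M"
        by measurable
    qed (auto simp: indicator_def)
    have "(LINT x|?M. f x * of_real (indicator {c<..<d} x)) = integral {a<..<b} (\<lambda>x. f x * of_real (indicator {c<..<d} x))"
      by (rule lebesgue_integral_eq_integral[OF int]) simp
    also have "\<dots> = integral {a<..<b} (\<lambda>x. if x \<in> {c<..<d} then F x else 0)"
      by (rule integral_cong) (auto simp: F_def indicator_def)
    also have "\<dots> = integral ({c<..<d} \<inter> {a<..<b}) F"
      by (simp only: integral_restrict_Int)
    also have "{c<..<d} \<inter> {a<..<b} = {c<..<d}" using cd by auto
    also have "integral {c<..<d} F = integral (cbox c d) F"
      by (simp add: integral_open_interval_real)
    finally show ?thesis using z by (simp add: Int_commute)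
  qed
  have "f absolutely_integrable_on {a<..<b}"
    using f by (simp add: absolutely_integrable_on_iff_nonneg set_integrable_def integrable_restrict_space)
  then have "f integrable_on {a<..<b}" by (rule absolutely_integrable_on_def[THEN iffD1, THEN conjunct1])
  then have "F integrable_on UNIV"
    unfolding F_def by (simp only: integrable_restrict_UNIV)
  then have "F integrable_on cbox c d" for c d
    by (rule integrable_on_subcbox) simp
  from integrable_ccontinuous_explicit[OF this] obtain N where N: "negligible N"
    "\<And>x e. \<lbrakk>x \<notin> N; 0 < e\<rbrakk> \<Longrightarrow> \<exists>d>0. \<forall>h. 0 < h \<and> h < d \<longrightarrow>
                         norm(integral (cbox x (x + h)) F /\<^sub>R h - F x) < e"
    by (auto simp: )
  have "f x = 0" if x: "x \<in> {a<..<b}" "x \<notin> N" for x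
  proof -
    have "norm (F x) < e" if e: "e > 0" for e
    proof -
      obtain d where d: "d > 0" "\<forall>h. 0 < h \<and> h < d \<longrightarrow> norm(integral (cbox x (x + h)) F /\<^sub>R h - F x) < e"
        using N(2)[OF x(2) e] by blast
      define h where "h = min d (b - x) / 2"
      have "0 < h" "h < d" "x + h < b" using d x by (auto simp: h_def min_def field_simps)
      with zero[of x "x+h"] x d show ?thesis by auto
    qed
    then have "norm (F x) \<le> 0" by (metis dual_order.irrefl not_le)
    then show ?thesis using x by (simp add: F_def)
  qed
  moreover have "AE x in lebesgue. x \<notin> N"
    using N(1) by (simp add: negligible_iff_null_sets AE_not_in)
  ultimately show ?thesis
    by (auto simp: AE_restrict_space_iff elim!: AE_mp)
qed

section \<open>Weak derivatives of functions\<close>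

lemma finite_measure_Ioo: "finite_measure (lebesgue_on {a<..<b::real})"
  by (rule finite_measure_lebesgue_on) simp

lemma continuous_imp_measurable_Ioo:
  fixes f :: "real \<Rightarrow> complex"
  assumes "continuous_on UNIV f"
  shows "f \<in> borel_measurable (lebesgue_on {a<..<b})"
  by (rule continuous_imp_measurable_on_sets_lebesgue) (auto intro: continuous_on_subset[OF assms])

lemma continuous_bounded_Ioo:
  fixes f :: "real \<Rightarrow> complex"
  assumes "continuous_on UNIV f"
  obtains B where "\<And>x. x \<in> {a<..<b} \<Longrightarrow> norm (f x) \<le> B"
proof -
  have "bounded (f ` {a..b})"
    by (intro compact_imp_bounded compact_continuous_image continuous_on_subset[OF assms]) auto
  then obtain B where "\<And>x. x \<in> {a..b} \<Longrightarrow> norm (f x) \<le> B"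
    unfolding bounded_iff by blast
  then show ?thesis by (intro that[of B]) auto
qed

lemma integrable_mult_continuous_Ioo:
  fixes f g :: "real \<Rightarrow> complex"
  assumes f: "integrable (lebesgue_on {a<..<b}) f" and g: "continuous_on UNIV g"
  shows "integrable (lebesgue_on {a<..<b}) (\<lambda>x. f x * g x)"
proof -
  obtain B where B: "\<And>x. x \<in> {a<..<b} \<Longrightarrow> norm (g x) \<le> B"
    using continuous_bounded_Ioo[OF g] by blast
  show ?thesis
  proof (rule Bochner_Integration.integrable_bound)
    show "integrable (lebesgue_on {a<..<b}) (\<lambda>x. of_real B * f x)" using f by simp
    show "(\<lambda>x. f x * g x) \<in> borel_measurable (lebesgue_on {a<..<b})"
      using f continuous_imp_measurable_Ioo[OF g] by (intro borel_measurable_times) auto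
    show "AE x in lebesgue_on {a<..<b}. norm (f x * g x) \<le> norm (of_real B * f x)"
    proof (rule AE_I2)
      fix x assume "x \<in> space (lebesgue_on {a<..<b})"
      then have "norm (g x) \<le> B" using B by simp
      then have "norm (g x) \<le> \<bar>B\<bar>" by linarith
      then show "norm (f x * g x) \<le> norm (of_real B * f x)"
        using mult_left_mono[of "norm (g x)" "\<bar>B\<bar>" "norm (f x)"] by (simp add: norm_mult mult.commute)
    qed
  qed
qed

lemma continuous_imp_integrable_Ioo:
  fixes f :: "real \<Rightarrow> complex"
  assumes "continuous_on UNIV f"
  shows "integrable (lebesgue_on {a<..<b}) f"
proof -
  interpret finite_measure "lebesgue_on {a<..<b}" by (rule finite_measure_Ioo)
  show ?thesis
    using integrable_mult_continuous_Ioo[OF integrable_const[of "1::complex"] assms] by simp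
qed

lemma test_functionD:
  assumes "test_function a b \<phi> \<phi>'"
  shows "(\<phi> has_vector_derivative \<phi>' x) (at x)" "continuous_on UNIV \<phi>'" "continuous_on UNIV \<phi>"
  using assms unfolding test_function_def
  by (auto intro: continuous_at_imp_continuous_on has_vector_derivative_continuous)

lemma test_function_support:
  assumes "test_function a b \<phi> \<phi>'" "a < b"
  obtains c d where "a < c" "c < d" "d < b" "\<And>x. x \<notin> {c..d} \<Longrightarrow> \<phi> x = 0"
proof -
  \<comment> \<open>The two extra points force \<open>c < d\<close>, also for the zero function.\<close>
  define K where "K = closure {x. \<phi> x \<noteq> 0} \<union> {a + (b - a) / 3, b - (b - a) / 3}"
  have sub: "K \<subseteq> {a<..<b}"
    using assms unfolding K_def test_function_def by (auto simp: field_simps)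
  have "bounded K" using sub bounded_subset[OF bounded_box[of a b]] by (simp add: box_real)
  moreover have "closed K" by (auto simp: K_def)
  ultimately have "compact K" by (simp add: compact_eq_bounded_closed)
  moreover have "K \<noteq> {}" by (simp add: K_def)
  ultimately obtain c d where cd: "c \<in> K" "\<And>x. x \<in> K \<Longrightarrow> c \<le> x" "d \<in> K" "\<And>x. x \<in> K \<Longrightarrow> x \<le> d"
    using compact_attains_inf[of K] compact_attains_sup[of K] by metis
  show ?thesis
  proof (rule that)
    show "a < c" "d < b" using cd sub by auto
    have "a + (b - a) / 3 \<in> K" "b - (b - a) / 3 \<in> K" by (auto simp: K_def)
    then have "c \<le> a + (b - a) / 3" "b - (b - a) / 3 \<le> d" using cd by auto
    then show "c < d" using \<open>a < b\<close> by argo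
    show "\<phi> x = 0" if "x \<notin> {c..d}" for x
    proof (rule ccontr)
      assume "\<phi> x \<noteq> 0"
      then have "x \<in> K" using closure_subset[of "{x. \<phi> x \<noteq> 0}"] by (auto simp: K_def)
      then show False using cd that by auto
    qed
  qed
qed

lemma integral_Ioo_eq:
  fixes f :: "real \<Rightarrow> complex"
  assumes "continuous_on UNIV f"
  shows "(LINT x|lebesgue_on {a<..<b}. f x) = integral {a..b} f"
  using lebesgue_integral_eq_integral[OF continuous_imp_integrable_Ioo[OF assms, of a b]]
  by (simp add: integral_open_interval_real)

text \<open>Weak differentiation of representatives instead of almost-everywhere classes. Integrability is built in
so that integrals of sums against test functions split.\<close>

definition weak_derivative_fun :: "real \<Rightarrow> real \<Rightarrow> (real \<Rightarrow> complex) \<Rightarrow> (real \<Rightarrow> complex) \<Rightarrow> bool" where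
  "weak_derivative_fun a b f g \<longleftrightarrow>
     integrable (lebesgue_on {a<..<b}) f \<and> integrable (lebesgue_on {a<..<b}) g \<and>
     (\<forall>\<phi> \<phi>'. test_function a b \<phi> \<phi>' \<longrightarrow>
        (LINT x|lebesgue_on {a<..<b}. f x * \<phi>' x) = - (LINT x|lebesgue_on {a<..<b}. g x * \<phi> x))"

lemma weak_derivative_funD:
  assumes "weak_derivative_fun a b f g"
  shows "integrable (lebesgue_on {a<..<b}) f" "integrable (lebesgue_on {a<..<b}) g"
    "test_function a b \<phi> \<phi>' \<Longrightarrow>
       (LINT x|lebesgue_on {a<..<b}. f x * \<phi>' x) = - (LINT x|lebesgue_on {a<..<b}. g x * \<phi> x)"
  using assms unfolding weak_derivative_fun_def by auto

lemma weak_derivative_fun_unique: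
  assumes "weak_derivative_fun a b f g" "weak_derivative_fun a b f h"
  shows "AE x in lebesgue_on {a<..<b}. g x = h x"
proof -
  have "AE x in lebesgue_on {a<..<b}. g x - h x = 0"
  proof (rule du_Bois_Reymond)
    fix \<phi> \<phi>' assume t: "test_function a b \<phi> \<phi>'"
    have "integrable (lebesgue_on {a<..<b}) (\<lambda>x. g x * \<phi> x)" "integrable (lebesgue_on {a<..<b}) (\<lambda>x. h x * \<phi> x)"
      using assms test_functionD[OF t] by (auto intro: integrable_mult_continuous_Ioo weak_derivative_funD)
    then show "(LINT x|lebesgue_on {a<..<b}. (g x - h x) * \<phi> x) = 0"
      using weak_derivative_funD(3)[OF assms(1) t] weak_derivative_funD(3)[OF assms(2) t]
      by (simp add: left_diff_distrib)
  qed (intro Bochner_Integration.integrable_diff weak_derivative_funD(2)[OF assms(1)] weak_derivative_funD(2)[OF assms(2)])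
  then show ?thesis by simp
qed

lemma weak_derivative_fun_cong_AE:
  assumes w: "weak_derivative_fun a b f g"
    and f: "AE x in lebesgue_on {a<..<b}. f' x = f x" "integrable (lebesgue_on {a<..<b}) f'"
    and g: "AE x in lebesgue_on {a<..<b}. g' x = g x" "integrable (lebesgue_on {a<..<b}) g'"
  shows "weak_derivative_fun a b f' g'"
  unfolding weak_derivative_fun_def
proof (intro conjI allI impI f g)
  fix \<phi> \<phi>' assume t: "test_function a b \<phi> \<phi>'"
  note [measurable] = continuous_imp_measurable_Ioo[OF test_functionD(2)[OF t], of a b]
    continuous_imp_measurable_Ioo[OF test_functionD(3)[OF t], of a b]
    borel_measurable_integrable[OF f(2)] borel_measurable_integrable[OF g(2)]
    borel_measurable_integrable[OF weak_derivative_funD(1)[OF w]] borel_measurable_integrable[OF weak_derivative_funD(2)[OF w]]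
  have "(LINT x|lebesgue_on {a<..<b}. f' x * \<phi>' x) = (LINT x|lebesgue_on {a<..<b}. f x * \<phi>' x)"
    using f(1) by (intro integral_cong_AE) auto
  moreover have "(LINT x|lebesgue_on {a<..<b}. g' x * \<phi> x) = (LINT x|lebesgue_on {a<..<b}. g x * \<phi> x)"
    using g(1) by (intro integral_cong_AE) auto
  ultimately show "(LINT x|lebesgue_on {a<..<b}. f' x * \<phi>' x) = - (LINT x|lebesgue_on {a<..<b}. g' x * \<phi> x)"
    using weak_derivative_funD(3)[OF w t] by simp
qed

lemma weak_derivative_fun_lincomb:
  assumes w: "weak_derivative_fun a b f g" "weak_derivative_fun a b f' g'"
  shows "weak_derivative_fun a b (\<lambda>x. c * f x + d * f' x) (\<lambda>x. c * g x + d * g' x)"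
  unfolding weak_derivative_fun_def
proof (intro conjI allI impI)
  fix \<phi> \<phi>' assume t: "test_function a b \<phi> \<phi>'"
  note i = integrable_mult_continuous_Ioo[OF weak_derivative_funD(1)[OF w(1)] test_functionD(2)[OF t]]
    integrable_mult_continuous_Ioo[OF weak_derivative_funD(2)[OF w(1)] test_functionD(3)[OF t]]
    integrable_mult_continuous_Ioo[OF weak_derivative_funD(1)[OF w(2)] test_functionD(2)[OF t]]
    integrable_mult_continuous_Ioo[OF weak_derivative_funD(2)[OF w(2)] test_functionD(3)[OF t]]
  show "(LINT x|lebesgue_on {a<..<b}. (c * f x + d * f' x) * \<phi>' x) = - (LINT x|lebesgue_on {a<..<b}. (c * g x + d * g' x) * \<phi> x)"
    using i weak_derivative_funD(3)[OF w(1) t] weak_derivative_funD(3)[OF w(2) t]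
    by (simp add: distrib_right mult.assoc)
qed (use w[THEN weak_derivative_funD(1)] w[THEN weak_derivative_funD(2)] in auto)

text \<open>The Leibniz rule: the product of a test function with a \<open>C\<^sup>1\<close> factor is again a test function.\<close>

lemma weak_derivative_fun_mult_smooth:
  assumes w: "weak_derivative_fun a b f g"
    and e: "\<And>x. (e has_vector_derivative e' x) (at x)" "continuous_on UNIV e'"
  shows "weak_derivative_fun a b (\<lambda>x. f x * e x) (\<lambda>x. g x * e x + f x * e' x)"
  unfolding weak_derivative_fun_def
proof (intro conjI allI impI)
  have ce: "continuous_on UNIV e"
    by (meson continuous_at_imp_continuous_on e(1) has_vector_derivative_continuous)
  show "integrable (lebesgue_on {a<..<b}) (\<lambda>x. f x * e x)"
    by (intro integrable_mult_continuous_Ioo weak_derivative_funD(1)[OF w] ce)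
  show "integrable (lebesgue_on {a<..<b}) (\<lambda>x. g x * e x + f x * e' x)"
    by (intro Bochner_Integration.integrable_add integrable_mult_continuous_Ioo
          weak_derivative_funD(1)[OF w] weak_derivative_funD(2)[OF w] ce e(2))+
  fix \<phi> \<phi>' assume t: "test_function a b \<phi> \<phi>'"
  have t': "test_function a b (\<lambda>x. e x * \<phi> x) (\<lambda>x. e x * \<phi>' x + e' x * \<phi> x)"
    unfolding test_function_def
  proof (intro conjI allI)
    show "((\<lambda>x. e x * \<phi> x) has_vector_derivative e x * \<phi>' x + e' x * \<phi> x) (at x)" for x
      by (rule has_vector_derivative_mult[OF e(1) test_functionD(1)[OF t]])
    show "continuous_on UNIV (\<lambda>x. e x * \<phi>' x + e' x * \<phi> x)"
      by (intro continuous_intros e ce test_functionD[OF t])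
    have "{x. e x * \<phi> x \<noteq> 0} \<subseteq> {x. \<phi> x \<noteq> 0}" by auto
    from closure_mono[OF this] show "closure {x. e x * \<phi> x \<noteq> 0} \<subseteq> {a<..<b}"
      using t by (auto simp: test_function_def)
  qed
  note i = integrable_mult_continuous_Ioo[OF weak_derivative_funD(1)[OF w] continuous_on_mult[OF ce test_functionD(2)[OF t]]]
   integrable_mult_continuous_Ioo[OF weak_derivative_funD(2)[OF w] continuous_on_mult[OF ce test_functionD(3)[OF t]]]
   integrable_mult_continuous_Ioo[OF weak_derivative_funD(1)[OF w] continuous_on_mult[OF e(2) test_functionD(3)[OF t]]]
  show "(LINT x|lebesgue_on {a<..<b}. f x * e x * \<phi>' x) = - (LINT x|lebesgue_on {a<..<b}. (g x * e x + f x * e' x) * \<phi> x)"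
    using weak_derivative_funD(3)[OF w t'] i
    by (simp add: distrib_left distrib_right mult.assoc add_eq_0_iff2 eq_neg_iff_add_eq_0 add_ac)
qed

lemma weak_derivative_fun_smooth:
  assumes e: "\<And>x. (e has_vector_derivative e' x) (at x)" "continuous_on UNIV e'" and "a < b"
  shows "weak_derivative_fun a b e e'"
proof -
  interpret finite_measure "lebesgue_on {a<..<b}" by (rule finite_measure_Ioo)
  \<comment> \<open>By the Leibniz rule it is enough to differentiate the constant 1 weakly.\<close>
  have "weak_derivative_fun a b (\<lambda>x. 1) (\<lambda>x. 0)"
    unfolding weak_derivative_fun_def
  proof (intro conjI allI impI)
    fix \<phi> \<phi>' assume t: "test_function a b \<phi> \<phi>'"
    obtain c d where cd: "a < c" "c < d" "d < b" "\<And>x. x \<notin> {c..d} \<Longrightarrow> \<phi> x = 0"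
      using test_function_support[OF t \<open>a < b\<close>] by metis
    have "(LINT x|lebesgue_on {a<..<b}. \<phi>' x) = integral {a..b} \<phi>'"
      by (rule integral_Ioo_eq[OF test_functionD(2)[OF t]])
    also have "\<dots> = \<phi> b - \<phi> a"
      using \<open>a < b\<close> test_functionD(1)[OF t]
      by (intro integral_unique fundamental_theorem_of_calculus) (auto intro: has_vector_derivative_at_within)
    also have "\<dots> = 0" using cd by auto
    finally show "(LINT x|lebesgue_on {a<..<b}. 1 * \<phi>' x) = - (LINT x|lebesgue_on {a<..<b}. 0 * \<phi> x)"
      by simp
  qed auto
  from weak_derivative_fun_mult_smooth[OF this e] show ?thesis by simp
qed

text \<open>Test functions with mean zero are the derivatives of test functions: the antiderivative vanishes to
the left of the support, and to its right because the total integral is zero.\<close>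

lemma test_function_antiderivative:
  assumes c: "continuous_on UNIV \<eta>" and cd: "a < c" "d < b" "c \<le> d"
    and z: "\<And>x. x \<notin> {c..d} \<Longrightarrow> \<eta> x = 0" and i: "integral {a..b} \<eta> = 0"
  shows "\<exists>\<Phi>. test_function a b \<Phi> \<eta>"
proof (intro exI)
  let ?\<Phi> = "\<lambda>x. integral {a..x} \<eta>"
  have int: "\<eta> integrable_on {s..t}" for s t
    by (intro integrable_continuous_interval continuous_on_subset[OF c]) simp
  have left: "?\<Phi> x = 0" if "x < c" for x
  proof -
    have "?\<Phi> x = integral {a..x} (\<lambda>_. 0)" using that z by (intro integral_cong) auto
    then show ?thesis by simp
  qed
  have right: "?\<Phi> x = 0" if "x > d" for x
  proof -
    have "integral {d..y} \<eta> = 0" if "y > d" for y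
    proof -
      have "integral {d..y} \<eta> = integral {d..y} (\<lambda>_. 0)"
        by (rule integral_spike[of "{d}"]) (use z in auto)
      then show ?thesis by simp
    qed
    moreover have "integral {a..d} \<eta> + integral {d..y} \<eta> = ?\<Phi> y" if "y > d" for y
      using cd that by (intro Henstock_Kurzweil_Integration.integral_combine int) auto
    ultimately have "?\<Phi> x = integral {a..d} \<eta>" "?\<Phi> b = integral {a..d} \<eta>" using that cd by (metis add.right_neutral)+
    then show ?thesis using i by simp
  qed
  show "test_function a b ?\<Phi> \<eta>"
    unfolding test_function_def
  proof (intro conjI allI c)
    fix x
    show "(?\<Phi> has_vector_derivative \<eta> x) (at x)"
    proof (cases "x < c")
      case True
      have "((\<lambda>_. 0) has_vector_derivative \<eta> x) (at x)" using z[of x] True by simp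
      then show ?thesis
        by (rule has_vector_derivative_transform_within_open[of _ _ _ "{..<c}"]) (use True left in auto)
    next
      case False
      have "(?\<Phi> has_vector_derivative \<eta> x) (at x within {a..x+1})"
        using False cd by (intro integral_has_vector_derivative continuous_on_subset[OF c]) auto
      moreover have "at x within {a..x+1} = at x"
        using False cd by (intro at_within_Icc_at) auto
      ultimately show ?thesis by simp
    qed
    have "closure {x. ?\<Phi> x \<noteq> 0} \<subseteq> {c..d}"
    proof (rule closure_minimal)
      show "{x. ?\<Phi> x \<noteq> 0} \<subseteq> {c..d}" using left right by (force simp: not_less)
    qed simp
    then show "closure {x. ?\<Phi> x \<noteq> 0} \<subseteq> {a<..<b}" using cd by auto
  qed
qed

text \<open>Fix a bump \<open>P\<close> of integral \<open>I\<close> and set \<open>C = \<integral> f P / I\<close>. For a test function \<open>\<psi>\<close> the function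
\<open>\<psi> - (\<integral>\<psi>) P / I\<close> has mean zero, so it is the derivative of a test function and \<open>f\<close> is orthogonal to it.
Hence \<open>f - C\<close> is orthogonal to every \<open>\<psi>\<close>.\<close>

lemma weak_derivative_fun_zero_imp_const:
  assumes w: "weak_derivative_fun a b f (\<lambda>x. 0)" and "a < b"
  shows "\<exists>c. AE x in lebesgue_on {a<..<b}. f x = c"
proof -
  let ?M = "lebesgue_on {a<..<b}"
  note f = weak_derivative_funD(1)[OF w]
  define c0 d0 where "c0 = a + (b - a) / 3" and "d0 = b - (b - a) / 3"
  have cd0: "a < c0" "c0 < d0" "d0 < b" using \<open>a < b\<close> by (auto simp: c0_def d0_def field_simps)
  define P where "P = (\<lambda>x. complex_of_real (parabola_bump c0 d0 x))"
  define I where "I = integral {a..b} P"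
  have cP: "continuous_on UNIV P"
    unfolding P_def by (intro continuous_intros)
  have "I \<noteq> 0"
  proof
    assume "I = 0"
    have "integral {a..b} (parabola_bump c0 d0) = 0"
    proof -
      have "(parabola_bump c0 d0 has_integral integral {a..b} (parabola_bump c0 d0)) {a..b}"
        by (intro integrable_integral integrable_continuous_interval continuous_parabola_bump)
      from has_integral_of_real[OF this]
      have "I = of_real (integral {a..b} (parabola_bump c0 d0))"
        unfolding I_def P_def o_def by (rule integral_unique)
      then show ?thesis using \<open>I = 0\<close> by simp
    qed
    then have "parabola_bump c0 d0 x = 0" if "x \<in> {a..b}" for x
      using integral_eq_0_iff[OF continuous_parabola_bump \<open>a < b\<close>, of c0 d0] parabola_bump_nonneg that by auto
    moreover have "(a + b) / 2 \<in> {c0<..<d0}" "(a + b) / 2 \<in> {a..b}"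
      using \<open>a < b\<close> by (auto simp: c0_def d0_def field_simps)
    ultimately show False using parabola_bump_eq_0_iff[OF cd0(2)] by blast
  qed
  define C where "C = (LINT x|?M. f x * (P x / I))"
  have "AE x in ?M. f x - C = 0"
  proof (rule du_Bois_Reymond)
    interpret finite_measure ?M by (rule finite_measure_Ioo)
    show "integrable ?M (\<lambda>x. f x - C)" using f by simp
    fix \<psi> \<psi>' assume t: "test_function a b \<psi> \<psi>'"
    note c\<psi> = test_functionD(3)[OF t]
    obtain c d where cd: "a < c" "c < d" "d < b" "\<And>x. x \<notin> {c..d} \<Longrightarrow> \<psi> x = 0"
      using test_function_support[OF t \<open>a < b\<close>] by metis
    define K where "K = (LINT x|?M. \<psi> x)"
    define \<eta> where "\<eta> = (\<lambda>x. \<psi> x - K * (P x / I))"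
    have c\<eta>: "continuous_on UNIV \<eta>"
      unfolding \<eta>_def using \<open>I \<noteq> 0\<close> by (intro continuous_intros c\<psi> cP) auto
    have iP: "integral {a..b} (\<lambda>x. K * (P x / I)) = K"
    proof -
      have "integral {a..b} (\<lambda>x. K * (P x / I)) = integral {a..b} (\<lambda>x. (K / I) * P x)"
        by (rule integral_cong) simp
      also have "\<dots> = (K / I) * integral {a..b} P" by (rule integral_mult_right)
      finally show ?thesis using \<open>I \<noteq> 0\<close> by (simp add: I_def)
    qed
    have "integral {a..b} \<eta> = integral {a..b} \<psi> - integral {a..b} (\<lambda>x. K * (P x / I))"
      unfolding \<eta>_def using \<open>I \<noteq> 0\<close>
      by (intro Henstock_Kurzweil_Integration.integral_diff integrable_continuous_interval continuous_intros continuous_on_subset[OF c\<psi>] continuous_on_subset[OF cP]) auto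
    also have "\<dots> = 0" unfolding iP by (simp add: K_def integral_Ioo_eq[OF c\<psi>])
    finally have i\<eta>: "integral {a..b} \<eta> = 0" .
    have "\<eta> x = 0" if "x \<notin> {min c c0..max d d0}" for x
    proof -
      have "x \<notin> {c..d}" "x \<notin> {c0<..<d0}" using that by auto
      then show ?thesis using cd(4) parabola_bump_eq_0_iff[OF cd0(2), of x] by (simp add: \<eta>_def P_def)
    qed
    moreover have "a < min c c0" "max d d0 < b" "min c c0 \<le> max d d0" using cd cd0 by auto
    ultimately obtain \<Phi> where "test_function a b \<Phi> \<eta>"
      using test_function_antiderivative[OF c\<eta>, of a "min c c0" "max d d0" b] i\<eta> by blast
    from weak_derivative_funD(3)[OF w this] have "(LINT x|?M. f x * \<eta> x) = 0" by simp
    moreover have "(LINT x|?M. f x * \<eta> x) = (LINT x|?M. f x * \<psi> x) - K * C"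
    proof -
      have "integrable ?M (\<lambda>x. f x * \<psi> x)" "integrable ?M (\<lambda>x. f x * (P x / I))"
        using \<open>I \<noteq> 0\<close> by (intro integrable_mult_continuous_Ioo f c\<psi> continuous_intros cP; simp)+
      then show ?thesis
        unfolding \<eta>_def C_def by (simp add: right_diff_distrib mult.left_commute[of _ K] del: times_divide_eq_right)
    qed
    moreover have "(LINT x|?M. (f x - C) * \<psi> x) = (LINT x|?M. f x * \<psi> x) - C * K"
      using integrable_mult_continuous_Ioo[OF f c\<psi>] continuous_imp_integrable_Ioo[OF c\<psi>]
      by (simp add: left_diff_distrib K_def)
    ultimately show "(LINT x|?M. (f x - C) * \<psi> x) = 0" by simp
  qed
  then show ?thesis by auto
qed

lemma exp_has_vector_derivative:
  "((\<lambda>x. exp (m * of_real x)) has_vector_derivative m * exp (m * of_real x)) (at (x::real))" for m :: complex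
proof -
  have "((\<lambda>z. exp (m * z)) has_field_derivative exp (m * of_real x) * m) (at (of_real x))"
    by (auto intro!: derivative_eq_intros)
  from field_vector_diff_chain_at[OF has_vector_derivative_of_real[OF DERIV_ident] this]
  show ?thesis by (simp add: o_def mult_ac)
qed

text \<open>Multiplication by the integrating factor \<open>exp (- m x)\<close> reduces the weak equation \<open>f' = m f\<close> to
a vanishing weak derivative, so that no regularity of \<open>f\<close> has to be established first.\<close>

lemma weak_derivative_fun_eigen:
  assumes w: "weak_derivative_fun a b f (\<lambda>x. m * f x)" and "a < b"
  shows "\<exists>c. AE x in lebesgue_on {a<..<b}. f x = c * exp (m * of_real x)"
proof -
  let ?e = "\<lambda>x. exp (- m * of_real x)"
  have "weak_derivative_fun a b (\<lambda>x. f x * ?e x) (\<lambda>x. m * f x * ?e x + f x * (- m * ?e x))"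
    by (intro weak_derivative_fun_mult_smooth[OF w] exp_has_vector_derivative continuous_intros)
  then have "weak_derivative_fun a b (\<lambda>x. f x * ?e x) (\<lambda>x. 0)"
    by (simp add: mult_ac)
  from weak_derivative_fun_zero_imp_const[OF this \<open>a < b\<close>] obtain c
    where c: "AE x in lebesgue_on {a<..<b}. f x * ?e x = c" by blast
  have "f x = c * exp (m * of_real x)" if "f x * ?e x = c" for x
  proof -
    have "c * exp (m * of_real x) = f x * (?e x * exp (m * of_real x))"
      using that by (simp only: mult.assoc[symmetric])
    also have "?e x * exp (m * of_real x) = 1" by (simp add: exp_add[symmetric])
    finally show ?thesis by simp
  qed
  with c have "AE x in lebesgue_on {a<..<b}. f x = c * exp (m * of_real x)"
    by (auto elim: AE_mp)
  then show ?thesis by blast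
qed

text \<open>The weak equation \<open>f'' = m\<^sup>2 f\<close> factors: \<open>q = f' + m f\<close> and \<open>p = f' - m f\<close> solve \<open>q' = m q\<close> and
\<open>p' = - m p\<close>, and \<open>f = (q - p) / (2 m)\<close>.\<close>

lemma weak_derivative_fun_second_order:
  assumes w: "weak_derivative_fun a b f g" "weak_derivative_fun a b g (\<lambda>x. m\<^sup>2 * f x)"
    and "a < b" "m \<noteq> 0"
  shows "\<exists>c d. AE x in lebesgue_on {a<..<b}. f x = c * exp (m * of_real x) + d * exp (- m * of_real x)"
proof -
  have "weak_derivative_fun a b (\<lambda>x. 1 * g x + m * f x) (\<lambda>x. m * (1 * g x + m * f x))"
    using weak_derivative_fun_lincomb[OF w(2,1), of 1 m] by (simp add: algebra_simps power2_eq_square)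
  from weak_derivative_fun_eigen[OF this \<open>a < b\<close>] obtain q where
    q: "AE x in lebesgue_on {a<..<b}. g x + m * f x = q * exp (m * of_real x)" by auto
  have "weak_derivative_fun a b (\<lambda>x. 1 * g x + (-m) * f x) (\<lambda>x. (-m) * (1 * g x + (-m) * f x))"
    using weak_derivative_fun_lincomb[OF w(2,1), of 1 "-m"] by (simp add: algebra_simps power2_eq_square)
  from weak_derivative_fun_eigen[OF this \<open>a < b\<close>] obtain p where
    p: "AE x in lebesgue_on {a<..<b}. g x - m * f x = p * exp (- m * of_real x)" by auto
  have "AE x in lebesgue_on {a<..<b}. f x = q / (2*m) * exp (m * of_real x) + (- p / (2*m)) * exp (- m * of_real x)"
    using p q
  proof eventually_elim
    case (elim x)
    then have "2 * m * f x = q * exp (m * of_real x) - p * exp (- m * of_real x)"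
      by (simp add: algebra_simps)
    then show ?case using \<open>m \<noteq> 0\<close> by (simp add: field_simps)
  qed
  then show ?thesis by blast
qed

section \<open>Almost-everywhere classes, Sobolev spaces and traces\<close>

lemma ae_class_eq_iff:
  "ae_class a b f = ae_class a b g \<longleftrightarrow> (AE x in lebesgue_on {a<..<b}. f x = g x)"
proof
  assume "ae_class a b f = ae_class a b g"
  moreover have "f \<in> ae_class a b f" by (simp add: ae_class_def)
  ultimately show "AE x in lebesgue_on {a<..<b}. f x = g x" by (simp add: ae_class_def)
next
  assume *: "AE x in lebesgue_on {a<..<b}. f x = g x"
  show "ae_class a b f = ae_class a b g"
    unfolding ae_class_def
  proof (intro Collect_cong iffI)
    fix h
    show "AE x in lebesgue_on {a<..<b}. h x = g x" if "AE x in lebesgue_on {a<..<b}. h x = f x"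
      using * that by eventually_elim simp
    show "AE x in lebesgue_on {a<..<b}. h x = f x" if "AE x in lebesgue_on {a<..<b}. h x = g x"
      using * that by eventually_elim simp
  qed
qed

text \<open>Lebesgue measure is complete, so every member of the class of a measurable function is measurable.
Since \<^const>\<open>has_weak_derivative\<close> and \<^const>\<open>L2_norm\<close> refer to arbitrary members of a class, all
representatives have to be controlled.\<close>

lemma borel_measurable_lebesgue_on_cong_AE:
  fixes f g :: "real \<Rightarrow> complex"
  assumes f: "f \<in> borel_measurable (lebesgue_on {a<..<b})"
    and ae: "AE x in lebesgue_on {a<..<b}. f x = g x"
  shows "g \<in> borel_measurable (lebesgue_on {a<..<b})"
proof -
  let ?r = "\<lambda>f x. if x \<in> {a<..<b} then f x else (0::complex)"
  have S: "{a<..<b} \<in> sets lebesgue" by simp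
  have "?r f \<in> borel_measurable lebesgue"
    using f by (simp only: borel_measurable_if[OF S])
  moreover have "AE x in lebesgue. ?r f x = ?r g x"
    using ae by (auto simp: AE_restrict_space_iff elim: AE_mp)
  ultimately have "?r g \<in> borel_measurable lebesgue"
    by (rule borel_measurable_AE)
  then show ?thesis by (simp only: borel_measurable_if[OF S])
qed

lemma integrable_lebesgue_on_cong_AE:
  fixes f g :: "real \<Rightarrow> complex"
  assumes "integrable (lebesgue_on {a<..<b}) f" "AE x in lebesgue_on {a<..<b}. f x = g x"
  shows "integrable (lebesgue_on {a<..<b}) g"
  using assms borel_measurable_lebesgue_on_cong_AE[of f a b g] by (intro integrable_cong_AE_imp[OF assms(1)]) (auto elim: AE_mp)

lemma square_integrable_imp_integrable:
  assumes "square_integrable a b f"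
  shows "integrable (lebesgue_on {a<..<b}) f"
proof -
  interpret finite_measure "lebesgue_on {a<..<b}" by (rule finite_measure_Ioo)
  show ?thesis
  proof (rule Bochner_Integration.integrable_bound)
    show "integrable (lebesgue_on {a<..<b}) (\<lambda>x. 1 + (norm (f x))\<^sup>2)"
      using assms by (simp add: square_integrable_def)
    show "AE x in lebesgue_on {a<..<b}. norm (f x) \<le> norm (1 + (norm (f x))\<^sup>2)"
    proof (rule AE_I2)
      fix x
      have "0 \<le> (norm (f x) - 1)\<^sup>2" by simp
      also have "\<dots> = 1 + (norm (f x))\<^sup>2 - 2 * norm (f x)" by (simp add: power2_diff)
      finally have "norm (f x) \<le> 1 + (norm (f x))\<^sup>2" using norm_ge_zero[of "f x"] by linarith
      then show "norm (f x) \<le> norm (1 + (norm (f x))\<^sup>2)" by simp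
    qed
  qed (use assms in \<open>simp add: square_integrable_def\<close>)
qed

lemma continuous_imp_square_integrable:
  assumes "continuous_on UNIV f"
  shows "square_integrable a b f"
proof -
  have "integrable (lebesgue_on {a<..<b}) (\<lambda>x. complex_of_real ((norm (f x))\<^sup>2))"
    by (intro continuous_imp_integrable_Ioo continuous_intros assms)
  then have "integrable (lebesgue_on {a<..<b}) (\<lambda>x. Re (complex_of_real ((norm (f x))\<^sup>2)))"
    by (rule integrable_Re)
  then show ?thesis
    using continuous_imp_measurable_Ioo[OF assms] by (simp add: square_integrable_def)
qed

lemma ae_class_in_L2: "square_integrable a b f \<Longrightarrow> ae_class a b f \<in> L2 a b"
  by (simp add: L2_def)

lemma L2_E:
  assumes "F \<in> L2 a b" obtains f where "square_integrable a b f" "F = ae_class a b f"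
  using assms by (auto simp: L2_def)

lemma has_weak_derivative_ae_class_iff:
  assumes "integrable (lebesgue_on {a<..<b}) f" "integrable (lebesgue_on {a<..<b}) g"
  shows "has_weak_derivative a b (ae_class a b f) (ae_class a b g) \<longleftrightarrow> weak_derivative_fun a b f g"
proof
  assume "has_weak_derivative a b (ae_class a b f) (ae_class a b g)"
  moreover have "f \<in> ae_class a b f" "g \<in> ae_class a b g" by (simp_all add: ae_class_def)
  ultimately show "weak_derivative_fun a b f g"
    using assms by (simp add: weak_derivative_fun_def has_weak_derivative_def)
next
  assume w: "weak_derivative_fun a b f g"
  show "has_weak_derivative a b (ae_class a b f) (ae_class a b g)"
    unfolding has_weak_derivative_def
  proof (intro ballI allI impI)
    fix f' g' \<phi> \<phi>' assume f': "f' \<in> ae_class a b f" and g': "g' \<in> ae_class a b g" and t: "test_function a b \<phi> \<phi>'"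
    have ae: "AE x in lebesgue_on {a<..<b}. f' x = f x" "AE x in lebesgue_on {a<..<b}. g' x = g x"
      using f' g' by (simp_all add: ae_class_def)
    then have "AE x in lebesgue_on {a<..<b}. f x = f' x" "AE x in lebesgue_on {a<..<b}. g x = g' x"
      by (auto elim: AE_mp)
    then have "integrable (lebesgue_on {a<..<b}) f'" "integrable (lebesgue_on {a<..<b}) g'"
      using assms integrable_lebesgue_on_cong_AE by blast+
    from weak_derivative_fun_cong_AE[OF w ae(1) this(1) ae(2) this(2)] t
    show "(LINT x|lebesgue_on {a<..<b}. f' x * \<phi>' x) = - (LINT x|lebesgue_on {a<..<b}. g' x * \<phi> x)"
      by (rule weak_derivative_funD(3))
  qed
qed

lemma weak_deriv_ae_class:
  assumes w: "weak_derivative_fun a b f g" and g: "square_integrable a b g"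
  shows "weak_deriv a b (ae_class a b f) = ae_class a b g"
  unfolding weak_deriv_def
proof (rule the_equality)
  note i = weak_derivative_funD(1,2)[OF w]
  show "ae_class a b g \<in> L2 a b \<and> has_weak_derivative a b (ae_class a b f) (ae_class a b g)"
    using w g i by (simp add: ae_class_in_L2 has_weak_derivative_ae_class_iff)
  fix G assume G: "G \<in> L2 a b \<and> has_weak_derivative a b (ae_class a b f) G"
  then obtain h where h: "square_integrable a b h" "G = ae_class a b h"
    by (auto elim: L2_E)
  then have "weak_derivative_fun a b f h"
    using G i has_weak_derivative_ae_class_iff[OF i(1) square_integrable_imp_integrable[OF h(1)]] by simp
  from weak_derivative_fun_unique[OF this w] show "G = ae_class a b g"
    by (simp add: h ae_class_eq_iff)
qed

lemma ae_class_in_H1: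
  assumes "weak_derivative_fun a b f g" "square_integrable a b f" "square_integrable a b g"
  shows "ae_class a b f \<in> H1 a b"
  using assms has_weak_derivative_ae_class_iff[OF weak_derivative_funD(1,2)[OF assms(1)]]
  by (auto simp: H1_def ae_class_in_L2 intro!: bexI[of _ "ae_class a b g"])

lemma H1_E:
  assumes "F \<in> H1 a b"
  obtains f g where "weak_derivative_fun a b f g" "square_integrable a b f" "square_integrable a b g"
    "F = ae_class a b f" "weak_deriv a b F = ae_class a b g"
proof -
  obtain G where F: "F \<in> L2 a b" "G \<in> L2 a b" "has_weak_derivative a b F G"
    using assms by (auto simp: H1_def)
  obtain f g where fg: "square_integrable a b f" "F = ae_class a b f" "square_integrable a b g" "G = ae_class a b g"
    using F by (metis L2_E)
  then have w: "weak_derivative_fun a b f g"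
    using F has_weak_derivative_ae_class_iff square_integrable_imp_integrable by blast
  show ?thesis using that[OF w fg(1,3,2)] weak_deriv_ae_class[OF w fg(3)] fg by blast
qed

lemma H2_E:
  assumes "F \<in> H2 a b"
  obtains f g h where "weak_derivative_fun a b f g" "weak_derivative_fun a b g h"
    "square_integrable a b f" "square_integrable a b g" "square_integrable a b h"
    "F = ae_class a b f" "weak_deriv a b F = ae_class a b g" "weak_deriv a b (weak_deriv a b F) = ae_class a b h"
proof -
  have F: "F \<in> H1 a b" "weak_deriv a b F \<in> H1 a b" using assms by (auto simp: H2_def)
  obtain f g where f: "weak_derivative_fun a b f g" "square_integrable a b f" "square_integrable a b g"
    "F = ae_class a b f" "weak_deriv a b F = ae_class a b g"
    using H1_E[OF F(1)] by metis
  obtain g' h where g: "weak_derivative_fun a b g' h" "square_integrable a b g'" "square_integrable a b h"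
    "weak_deriv a b F = ae_class a b g'" "weak_deriv a b (weak_deriv a b F) = ae_class a b h"
    using H1_E[OF F(2)] by metis
  have "ae_class a b g = ae_class a b g'" using f(5) g(4) by simp
  then have "AE x in lebesgue_on {a<..<b}. g x = g' x" by (simp add: ae_class_eq_iff)
  then have "weak_derivative_fun a b g h"
    by (rule weak_derivative_fun_cong_AE[OF g(1)]) (use f g in \<open>auto simp: square_integrable_imp_integrable\<close>)
  with f g show ?thesis using that by metis
qed

lemma smooth_class:
  assumes "\<And>x. (f has_vector_derivative f' x) (at x)" "continuous_on UNIV f'" "a < b"
  shows "ae_class a b f \<in> H1 a b" "weak_deriv a b (ae_class a b f) = ae_class a b f'"
proof -
  have c: "continuous_on UNIV f"
    by (meson continuous_at_imp_continuous_on assms(1) has_vector_derivative_continuous)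
  note w = weak_derivative_fun_smooth[OF assms]
  show "ae_class a b f \<in> H1 a b"
    by (rule ae_class_in_H1[OF w]) (intro continuous_imp_square_integrable c assms)+
  show "weak_deriv a b (ae_class a b f) = ae_class a b f'"
    by (rule weak_deriv_ae_class[OF w]) (intro continuous_imp_square_integrable assms)
qed

lemma smooth_class_H2:
  assumes "\<And>x. (f has_vector_derivative f' x) (at x)" "\<And>x. (f' has_vector_derivative f'' x) (at x)"
    "continuous_on UNIV f''" "a < b"
  shows "ae_class a b f \<in> H2 a b"
proof -
  have "continuous_on UNIV f'"
    by (meson continuous_at_imp_continuous_on assms(2) has_vector_derivative_continuous)
  then show ?thesis
    using smooth_class[OF assms(1) _ \<open>a < b\<close>] smooth_class[OF assms(2-4)] by (simp add: H2_def)
qed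

text \<open>Two continuous functions that differ at a point of \<open>[a,b]\<close> differ on a nontrivial interval inside
\<open>(a,b)\<close>, which is not a null set. This holds for end points, too, so boundary values are well defined.\<close>

lemma continuous_eq_of_AE_eq:
  fixes f g :: "real \<Rightarrow> complex"
  assumes "continuous_on {a..b} f" "continuous_on {a..b} g" "a < b"
    and ae: "AE x in lebesgue_on {a<..<b}. f x = g x" and t: "t \<in> {a..b}"
  shows "f t = g t"
proof (rule ccontr)
  assume ne: "f t \<noteq> g t"
  have "continuous_on {a..b} (\<lambda>x. f x - g x)" by (intro continuous_intros assms)
  then obtain d where d: "d > 0" "\<And>x. x \<in> {a..b} \<Longrightarrow> dist x t < d \<Longrightarrow> dist (f x - g x) (f t - g t) < norm (f t - g t)"
    using t ne unfolding continuous_on_iff by (metis right_minus_eq zero_less_norm_iff)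
  define l r where "l = max a (t - d)" and "r = min b (t + d)"
  have lr: "l < r" using t \<open>a < b\<close> \<open>d > 0\<close> by (auto simp: l_def r_def)
  have neq: "f x \<noteq> g x" if "x \<in> {l<..<r}" for x
  proof
    assume eq: "f x = g x"
    have "x \<in> {a..b}" "dist x t < d" using that by (auto simp: l_def r_def dist_real_def)
    from d(2)[OF this] eq show False by (simp add: dist_norm norm_minus_commute)
  qed
  have "AE x in lebesgue. x \<in> {a<..<b} \<longrightarrow> f x = g x"
    using ae by (simp add: AE_restrict_space_iff)
  then have "AE x in lebesgue. x \<notin> {l<..<r}"
    by eventually_elim (use neq in \<open>auto simp: l_def r_def\<close>)
  then have "{l<..<r} \<in> null_sets lebesgue" by (simp add: AE_iff_null_sets)
  then show False using lr by (simp add: null_sets_def)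
qed

lemma point_value_ae_class:
  assumes "continuous_on {a..b} f" "a < b" "t \<in> {a..b}"
  shows "point_value a b (ae_class a b f) t = f t"
  unfolding point_value_def
proof (rule the_equality)
  show "\<exists>g\<in>ae_class a b f. continuous_on {a..b} g \<and> g t = f t"
    using assms by (intro bexI[of _ f]) (auto simp: ae_class_def)
  fix c assume "\<exists>g\<in>ae_class a b f. continuous_on {a..b} g \<and> g t = c"
  then obtain g where g: "AE x in lebesgue_on {a<..<b}. g x = f x" "continuous_on {a..b} g" "g t = c"
    by (auto simp: ae_class_def)
  then show "c = f t" using continuous_eq_of_AE_eq[OF g(2) assms(1,2) g(1) assms(3)] by simp
qed

lemma L2_norm_ae_class:
  assumes f: "f \<in> borel_measurable (lebesgue_on {a<..<b})"
  shows "L2_norm a b (ae_class a b f) = sqrt (LINT x|lebesgue_on {a<..<b}. (norm (f x))\<^sup>2)"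
proof -
  define g where "g = (SOME g. g \<in> ae_class a b f)"
  have "g \<in> ae_class a b f" unfolding g_def by (rule someI[of _ f]) (simp add: ae_class_def)
  then have g: "AE x in lebesgue_on {a<..<b}. g x = f x" by (simp add: ae_class_def)
  then have "AE x in lebesgue_on {a<..<b}. f x = g x" by (auto elim: AE_mp)
  with f have [measurable]: "g \<in> borel_measurable (lebesgue_on {a<..<b})" by (rule borel_measurable_lebesgue_on_cong_AE)
  have "(LINT x|lebesgue_on {a<..<b}. (norm (g x))\<^sup>2) = (LINT x|lebesgue_on {a<..<b}. (norm (f x))\<^sup>2)"
    using g f by (intro integral_cong_AE) auto
  then show ?thesis by (simp add: L2_norm_def g_def)
qed

lemma L2_norm_scale:
  assumes f: "continuous_on UNIV f"
  shows "L2_norm a b (ae_class a b (\<lambda>x. k * f x)) = norm k * L2_norm a b (ae_class a b f)"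
  by (simp add: L2_norm_ae_class continuous_imp_measurable_Ioo continuous_intros f norm_mult power_mult_distrib real_sqrt_mult)

lemma L2_norm_pos:
  assumes f: "continuous_on UNIV f" and "a < b" "t \<in> {a..b}" "f t \<noteq> 0"
  shows "L2_norm a b (ae_class a b f) > 0"
proof (rule ccontr)
  assume "\<not> ?thesis"
  then have "(LINT x|lebesgue_on {a<..<b}. (norm (f x))\<^sup>2) \<le> 0"
    by (simp add: L2_norm_ae_class continuous_imp_measurable_Ioo f)
  moreover have "(LINT x|lebesgue_on {a<..<b}. (norm (f x))\<^sup>2) \<ge> 0" by simp
  ultimately have "(LINT x|lebesgue_on {a<..<b}. (norm (f x))\<^sup>2) = 0" by simp
  moreover have "integrable (lebesgue_on {a<..<b}) (\<lambda>x. (norm (f x))\<^sup>2)"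
    using continuous_imp_square_integrable[OF f] by (simp add: square_integrable_def)
  ultimately have "AE x in lebesgue_on {a<..<b}. (norm (f x))\<^sup>2 = 0"
    by (subst integral_nonneg_eq_0_iff_AE[symmetric]) auto
  then have "AE x in lebesgue_on {a<..<b}. f x = 0" by simp
  then have "f t = 0"
    using assms by (intro continuous_eq_of_AE_eq[of a b f "\<lambda>_. 0" t] continuous_on_subset[OF f]) auto
  with assms show False by simp
qed

section \<open>Eigenmodes of the operator\<close>

text \<open>The general solution of \<open>f'' = m\<^sup>2 f\<close> for \<open>m \<noteq> 0\<close>. The family is closed under differentiation and linear
combinations, which keeps all computations with classes on the level of coefficients.\<close>

definition exp_pair :: "complex \<Rightarrow> complex \<Rightarrow> complex \<Rightarrow> real \<Rightarrow> complex" where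
  "exp_pair m c d x = c * exp (m * of_real x) + d * exp (- m * of_real x)"

lemma exp_pair_has_vector_derivative:
  "(exp_pair m c d has_vector_derivative exp_pair m (m * c) (- m * d) x) (at x)"
proof -
  have "((\<lambda>x. c * exp (m * of_real x) + d * exp (- m * of_real x)) has_vector_derivative
     c * (m * exp (m * of_real x)) + d * (- m * exp (- m * of_real x))) (at x)"
    by (intro has_vector_derivative_add has_vector_derivative_mult_right exp_has_vector_derivative)
  then show ?thesis by (simp add: exp_pair_def[abs_def] mult_ac)
qed

lemma continuous_exp_pair [continuous_intros]: "continuous_on S (exp_pair m c d)"
  unfolding exp_pair_def by (intro continuous_intros)

lemma exp_pair_scale: "exp_pair m (k * c) (k * d) x = k * exp_pair m c d x"
  by (simp add: exp_pair_def algebra_simps)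

lemma exp_pair_eq_cosh: "exp_pair m (k * exp m) (k * exp (- m)) x = 2 * k * cosh (m * (of_real x + 1))"
  by (simp add: exp_pair_def cosh_field_def exp_add algebra_simps exp_diff exp_minus field_simps)

text \<open>The state with components \<open>u x = 2 \<alpha> cosh (l (x + 1))\<close>, \<open>v = l u\<close> and
\<open>w x = 2 \<gamma> sinh (m (1 - x))\<close>. If \<open>l = m\<^sup>2\<close>, then it solves the differential equations of an eigenvector for
\<open>l\<close>, and it satisfies the two outer boundary conditions \<open>u' (-1) = 0\<close> and \<open>w 1 = 0\<close>.
The two conditions at the interface \<open>0\<close> are left to \<open>\<alpha>\<close> and \<open>\<gamma>\<close>.\<close>

definition mode :: "complex \<Rightarrow> complex \<Rightarrow> complex \<Rightarrow> complex \<Rightarrow> state" where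
  "mode l m \<alpha> \<gamma> = 
    (ae_class (-1) 0 (exp_pair l (\<alpha> * exp l) (\<alpha> * exp (- l))),
     ae_class (-1) 0 (exp_pair l (l * (\<alpha> * exp l)) (l * (\<alpha> * exp (- l)))),
     ae_class 0 1 (exp_pair m (- (\<gamma> * exp (- m))) (\<gamma> * exp m)))"

lemma smooth_exp_pair:
  assumes "a < b"
  shows "ae_class a b (exp_pair m c d) \<in> H2 a b"
    "weak_deriv a b (ae_class a b (exp_pair m c d)) = ae_class a b (exp_pair m (m * c) (- m * d))"
    "ae_class a b (exp_pair m c d) \<in> H1 a b"
    "ae_class a b (exp_pair m c d) \<in> L2 a b"
proof -
  note d = exp_pair_has_vector_derivative and c = continuous_exp_pair
  show "ae_class a b (exp_pair m c d) \<in> H2 a b"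
    by (rule smooth_class_H2[OF d d c assms])
  show "weak_deriv a b (ae_class a b (exp_pair m c d)) = ae_class a b (exp_pair m (m * c) (- m * d))"
    "ae_class a b (exp_pair m c d) \<in> H1 a b"
    by (rule smooth_class[OF d c assms])+
  show "ae_class a b (exp_pair m c d) \<in> L2 a b"
    by (intro ae_class_in_L2 continuous_imp_square_integrable c)
qed

lemma mode_in_X_space: "mode l m \<alpha> \<gamma> \<in> X_space"
  by (simp add: mode_def X_space_def smooth_exp_pair)

lemma mode_in_A_dom:
  assumes "\<alpha> * l * cosh l = \<gamma> * sinh m" "\<alpha> * l * sinh l = - (\<gamma> * m * cosh m)"
  shows "mode l m \<alpha> \<gamma> \<in> A_dom"
proof -
  have e: "exp l = cosh l + sinh l" "exp (- l) = cosh l - sinh l" "exp m = cosh m + sinh m" "exp (- m) = cosh m - sinh m"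
    by (simp_all add: cosh_plus_sinh cosh_minus_sinh)
  have "l * (\<alpha> * exp l) + l * (\<alpha> * exp (- l)) = - (\<gamma> * exp (- m)) + \<gamma> * exp m"
    "l * (\<alpha> * exp l) - l * (\<alpha> * exp (- l)) = - (m * (\<gamma> * exp (- m))) - m * (\<gamma> * exp m)"
    using assms unfolding e by algebra+
  then show ?thesis
    unfolding A_dom_def mode_def Y_space_def
    by (simp add: smooth_exp_pair point_value_ae_class continuous_exp_pair)
       (simp add: exp_pair_def exp_minus field_simps)
qed

lemma A_op_mode:
  assumes "l = m\<^sup>2"
  shows "A_op (mode l m \<alpha> \<gamma>) =
    (ae_class (-1) 0 (exp_pair l (l * (\<alpha> * exp l)) (l * (\<alpha> * exp (- l)))),
     ae_class (-1) 0 (exp_pair l (l\<^sup>2 * (\<alpha> * exp l)) (l\<^sup>2 * (\<alpha> * exp (- l)))),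
     ae_class 0 1 (exp_pair m (l * (- (\<gamma> * exp (- m)))) (l * (\<gamma> * exp m))))"
  using assms by (simp add: mode_def smooth_exp_pair power2_eq_square mult_ac)

lemma exp_pair_scale_diff:
  "(\<lambda>x. k * exp_pair m c d x - exp_pair m c' d' x) = exp_pair m (k * c - c') (k * d - d')"
  by (rule ext) (simp add: exp_pair_def algebra_simps)

lemma z_minus_A_mode:
  assumes "l = m\<^sup>2"
  shows "z_minus_A z (mode l m \<alpha> \<gamma>) = mode l m ((z - l) * \<alpha>) ((z - l) * \<gamma>)"
  unfolding z_minus_A_def A_op_mode[OF assms]
  by (simp add: mode_def scale_diff_ae_class exp_pair_scale_diff)
     (simp add: power2_eq_square left_diff_distrib right_diff_distrib diff_divide_distrib mult_ac)

lemma X_norm_mode_scale: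
  "X_norm (mode l m (k * \<alpha>) (k * \<gamma>)) = norm k * X_norm (mode l m \<alpha> \<gamma>)"
proof -
  have s: "exp_pair n (k * c) (k * d) = (\<lambda>x. k * exp_pair n c d x)" for n c d
    by (rule ext) (simp add: exp_pair_scale)
  have L: "L2_norm a b (ae_class a b (exp_pair n (k * c) (k * d))) = norm k * L2_norm a b (ae_class a b (exp_pair n c d))" for a b n c d
    unfolding s by (rule L2_norm_scale[OF continuous_exp_pair])
  have sq: "sqrt ((norm k * A)\<^sup>2 + (norm k * B)\<^sup>2) = norm k * sqrt (A\<^sup>2 + B\<^sup>2)" for A B
    by (simp add: power_mult_distrib distrib_left[symmetric] real_sqrt_mult)
  have H: "H1_norm (-1) 0 (ae_class (-1) 0 (exp_pair n (k * c) (k * d))) = norm k * H1_norm (-1) 0 (ae_class (-1) 0 (exp_pair n c d))" for n c d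
    using L[of "-1" 0 n c d] L[of "-1" 0 n "n * c" "- n * d"]
    by (simp add: H1_norm_def smooth_exp_pair mult.left_commute[of n k] sq)
  define cu du cw dw where "cu = \<alpha> * exp l" and "du = \<alpha> * exp (- l)" and "cw = - (\<gamma> * exp (- m))" and "dw = \<gamma> * exp m"
  have "mode l m (k * \<alpha>) (k * \<gamma>) = (ae_class (-1) 0 (exp_pair l (k * cu) (k * du)),
     ae_class (-1) 0 (exp_pair l (k * (l * cu)) (k * (l * du))), ae_class 0 1 (exp_pair m (k * cw) (k * dw)))"
    and "mode l m \<alpha> \<gamma> = (ae_class (-1) 0 (exp_pair l cu du),
     ae_class (-1) 0 (exp_pair l (l * cu) (l * du)), ae_class 0 1 (exp_pair m cw dw))"
    by (simp_all add: mode_def cu_def du_def cw_def dw_def mult_ac)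
  then show ?thesis
    by (simp add: L H power_mult_distrib distrib_left[symmetric] real_sqrt_mult)
qed

lemma X_norm_mode_pos:
  assumes "\<alpha> \<noteq> 0"
  shows "X_norm (mode l m \<alpha> \<gamma>) > 0"
proof -
  let ?f = "exp_pair l (\<alpha> * exp l) (\<alpha> * exp (- l))"
  have "?f (-1) \<noteq> 0" using assms by (simp add: exp_pair_eq_cosh)
  then have "L2_norm (-1) 0 (ae_class (-1) 0 ?f) > 0"
    by (intro L2_norm_pos[where t = "-1"] continuous_exp_pair) auto
  then have "H1_norm (-1) 0 (ae_class (-1) 0 ?f) > 0"
    by (simp add: H1_norm_def add_pos_nonneg)
  then show ?thesis
    by (simp add: mode_def add_pos_nonneg)
qed

text \<open>The difference of \<open>x\<close> and the mode solves the homogeneous equations \<open>u'' = z\<^sup>2 u\<close> and \<open>w'' = z w\<close>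
weakly, hence is explicit. Therefore \<open>x\<close> itself is smooth, its traces can be computed, and the four
boundary conditions leave a linear system of determinant
\<open>n cosh n cosh z + sinh n sinh z\<close>, up to the factor \<open>- z\<close>. Stating this for preimages of a mode
rather than as injectivity on the whole domain avoids the embedding of \<open>H\<^sup>1\<close> into the continuous
functions.\<close>

lemma preimage_of_mode_unique:
  assumes x: "x \<in> A_dom" and M: "mode l m \<alpha> \<gamma> \<in> A_dom" and lm: "l = m\<^sup>2"
    and eq: "z_minus_A z x = z_minus_A z (mode l m \<alpha> \<gamma>)"
    and nz: "z = n\<^sup>2" "z \<noteq> 0" and nd: "n * cosh n * cosh z + sinh n * sinh z \<noteq> 0"
  shows "x = mode l m \<alpha> \<gamma>"
proof -
  obtain u v w where xe: "x = (u, v, w)" by (cases x)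
  note x = x[unfolded xe]
  have H: "u \<in> H2 (-1) 0" "v \<in> H1 (-1) 0" "w \<in> H2 0 1"
    using x by (auto simp: A_dom_def Y_space_def)
  obtain f0 f1 f2 where f: "weak_derivative_fun (-1) 0 f0 f1" "weak_derivative_fun (-1) 0 f1 f2"
    "u = ae_class (-1) 0 f0" "weak_deriv (-1) 0 (weak_deriv (-1) 0 u) = ae_class (-1) 0 f2"
    using H2_E[OF H(1)] by metis
  obtain g0 where g: "v = ae_class (-1) 0 g0" using H1_E[OF H(2)] by metis
  obtain h0 h1 h2 where h: "weak_derivative_fun 0 1 h0 h1" "weak_derivative_fun 0 1 h1 h2"
    "w = ae_class 0 1 h0" "weak_deriv 0 1 (weak_deriv 0 1 w) = ae_class 0 1 h2"
    using H2_E[OF H(3)] by metis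
  define cu du where "cu = \<alpha> * exp l" and "du = \<alpha> * exp (- l)"
  define cw dw where "cw = - (\<gamma> * exp (- m))" and "dw = \<gamma> * exp m"
  have mode: "mode l m \<alpha> \<gamma> = (ae_class (-1) 0 (exp_pair l cu du), ae_class (-1) 0 (exp_pair l (l * cu) (l * du)), ae_class 0 1 (exp_pair m cw dw))"
    by (simp add: mode_def cu_def du_def cw_def dw_def)
  have "z_minus_A z x = (ae_class (-1) 0 (\<lambda>x. z * f0 x - g0 x), ae_class (-1) 0 (\<lambda>x. z * g0 x - f2 x), ae_class 0 1 (\<lambda>x. z * h0 x - h2 x))"
    by (simp add: z_minus_A_def xe f(4) h(4)) (simp add: f(3) g h(3) scale_diff_ae_class)
  moreover have "z_minus_A z (mode l m \<alpha> \<gamma>) = (ae_class (-1) 0 (\<lambda>x. z * exp_pair l cu du x - exp_pair l (l * cu) (l * du) x),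
      ae_class (-1) 0 (\<lambda>x. z * exp_pair l (l * cu) (l * du) x - exp_pair l (l\<^sup>2 * cu) (l\<^sup>2 * du) x),
      ae_class 0 1 (\<lambda>x. z * exp_pair m cw dw x - exp_pair m (l * cw) (l * dw) x))"
    unfolding z_minus_A_def A_op_mode[OF lm]
    by (simp add: mode_def cu_def du_def cw_def dw_def scale_diff_ae_class)
  ultimately have "z_minus_A z x = z_minus_A z (mode l m \<alpha> \<gamma>) \<longleftrightarrow>
    (AE x in lebesgue_on {-1<..<0}. z * f0 x - g0 x = z * exp_pair l cu du x - l * exp_pair l cu du x) \<and>
    (AE x in lebesgue_on {-1<..<0}. z * g0 x - f2 x = z * (l * exp_pair l cu du x) - l\<^sup>2 * exp_pair l cu du x) \<and>
    (AE x in lebesgue_on {0<..<1}. z * h0 x - h2 x = z * exp_pair m cw dw x - l * exp_pair m cw dw x)"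
    by (simp only: ae_class_eq_iff exp_pair_scale prod.inject)
  then have ae:
    "AE x in lebesgue_on {-1<..<0}. z * f0 x - g0 x = z * exp_pair l cu du x - l * exp_pair l cu du x"
    "AE x in lebesgue_on {-1<..<0}. z * g0 x - f2 x = z * (l * exp_pair l cu du x) - l\<^sup>2 * exp_pair l cu du x"
    "AE x in lebesgue_on {0<..<1}. z * h0 x - h2 x = z * exp_pair m cw dw x - l * exp_pair m cw dw x"
    using eq by blast+
  \<comment> \<open>The differences from the mode solve the homogeneous equations.\<close>
  let ?D = "\<lambda>x. 1 * f0 x + (-1) * exp_pair l cu du x"
  have D1: "weak_derivative_fun (-1) 0 ?D (\<lambda>x. 1 * f1 x + (-1) * exp_pair l (l * cu) (- l * du) x)"
    by (intro weak_derivative_fun_lincomb f weak_derivative_fun_smooth exp_pair_has_vector_derivative continuous_exp_pair) simp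
  have "weak_derivative_fun (-1) 0 (\<lambda>x. 1 * f1 x + (-1) * exp_pair l (l * cu) (- l * du) x) (\<lambda>x. 1 * f2 x + (-1) * exp_pair l (l * (l * cu)) (- l * (- l * du)) x)"
    by (intro weak_derivative_fun_lincomb f weak_derivative_fun_smooth exp_pair_has_vector_derivative continuous_exp_pair) simp
  then have D2: "weak_derivative_fun (-1) 0 (\<lambda>x. 1 * f1 x + (-1) * exp_pair l (l * cu) (- l * du) x) (\<lambda>x. z\<^sup>2 * ?D x)"
  proof (rule weak_derivative_fun_cong_AE)
    have e: "exp_pair l (l * (l * cu)) (- l * (- l * du)) x = l\<^sup>2 * exp_pair l cu du x" for x
      by (simp add: exp_pair_def power2_eq_square algebra_simps)
    show "AE x in lebesgue_on {-1<..<0}. z\<^sup>2 * ?D x = 1 * f2 x + (-1) * exp_pair l (l * (l * cu)) (- l * (- l * du)) x"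
      using ae(1,2) unfolding e
    proof eventually_elim
      case (elim x)
      then show ?case by algebra
    qed
  qed (use weak_derivative_funD[OF D1] in \<open>simp_all only: integrable_mult_right simp_thms eventually_True\<close>)
  from weak_derivative_fun_second_order[OF D1 D2 _ \<open>z \<noteq> 0\<close>] obtain c d where
    "AE x in lebesgue_on {-1<..<0}. ?D x = c * exp (z * of_real x) + d * exp (- z * of_real x)" by auto
  then have ue: "AE x in lebesgue_on {-1<..<0}. f0 x = exp_pair l cu du x + exp_pair z c d x"
    by (rule AE_mp) (auto simp: exp_pair_def algebra_simps)
  have ve: "AE x in lebesgue_on {-1<..<0}. g0 x = l * exp_pair l cu du x + z * exp_pair z c d x"
    using ue ae(1) by eventually_elim (simp add: algebra_simps)
  let ?E = "\<lambda>x. 1 * h0 x + (-1) * exp_pair m cw dw x"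
  have E1: "weak_derivative_fun 0 1 ?E (\<lambda>x. 1 * h1 x + (-1) * exp_pair m (m * cw) (- m * dw) x)"
    by (intro weak_derivative_fun_lincomb h weak_derivative_fun_smooth exp_pair_has_vector_derivative continuous_exp_pair) simp
  have "weak_derivative_fun 0 1 (\<lambda>x. 1 * h1 x + (-1) * exp_pair m (m * cw) (- m * dw) x) (\<lambda>x. 1 * h2 x + (-1) * exp_pair m (m * (m * cw)) (- m * (- m * dw)) x)"
    by (intro weak_derivative_fun_lincomb h weak_derivative_fun_smooth exp_pair_has_vector_derivative continuous_exp_pair) simp
  then have E2: "weak_derivative_fun 0 1 (\<lambda>x. 1 * h1 x + (-1) * exp_pair m (m * cw) (- m * dw) x) (\<lambda>x. n\<^sup>2 * ?E x)"
  proof (rule weak_derivative_fun_cong_AE)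
    have e: "exp_pair m (m * (m * cw)) (- m * (- m * dw)) x = l * exp_pair m cw dw x" for x
      by (simp add: exp_pair_def lm power2_eq_square algebra_simps)
    show "AE x in lebesgue_on {0<..<1}. n\<^sup>2 * ?E x = 1 * h2 x + (-1) * exp_pair m (m * (m * cw)) (- m * (- m * dw)) x"
      using ae(3) unfolding e
    proof eventually_elim
      case (elim x)
      then show ?case unfolding nz(1) by algebra
    qed
  qed (use weak_derivative_funD[OF E1] in \<open>simp_all only: integrable_mult_right simp_thms eventually_True\<close>)
  have "n \<noteq> 0" using nz by auto
  from weak_derivative_fun_second_order[OF E1 E2 _ this] obtain p q where
    "AE x in lebesgue_on {0<..<1}. ?E x = p * exp (n * of_real x) + q * exp (- n * of_real x)" by auto
  then have we: "AE x in lebesgue_on {0<..<1}. h0 x = exp_pair m cw dw x + exp_pair n p q x"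
    by (rule AE_mp) (auto simp: exp_pair_def algebra_simps)
  \<comment> \<open>So \<open>x\<close> is smooth and its boundary values can be read off.\<close>
  let ?U = "\<lambda>x. exp_pair l cu du x + exp_pair z c d x"
  let ?U' = "\<lambda>x. exp_pair l (l * cu) (- l * du) x + exp_pair z (z * c) (- z * d) x"
  let ?V = "\<lambda>x. l * exp_pair l cu du x + z * exp_pair z c d x"
  let ?W = "\<lambda>x. exp_pair m cw dw x + exp_pair n p q x"
  let ?W' = "\<lambda>x. exp_pair m (m * cw) (- m * dw) x + exp_pair n (n * p) (- n * q) x"
  have u: "u = ae_class (-1) 0 ?U" and v: "v = ae_class (-1) 0 ?V" and w: "w = ae_class 0 1 ?W"
    using ue ve we by (simp_all add: f(3) g h(3) ae_class_eq_iff)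
  have cont: "continuous_on S ?U'" "continuous_on S ?V" "continuous_on S ?W" "continuous_on S ?W'" for S
    by (intro continuous_intros)+
  have u': "weak_deriv (-1) 0 u = ae_class (-1) 0 ?U'"
    unfolding u by (intro smooth_class(2) has_vector_derivative_add exp_pair_has_vector_derivative cont) simp
  have w': "weak_deriv 0 1 w = ae_class 0 1 ?W'"
    unfolding w by (intro smooth_class(2) has_vector_derivative_add exp_pair_has_vector_derivative cont) simp
  have bx: "?U' (-1) = 0" "?W 1 = 0" "?V 0 = ?W 0" "?U' 0 = ?W' 0"
  proof -
    have "point_value (-1) 0 (ae_class (-1) 0 ?U') (-1) = ?U' (-1)" "point_value 0 1 (ae_class 0 1 ?W) 1 = ?W 1"
      "point_value (-1) 0 (ae_class (-1) 0 ?V) 0 = ?V 0" "point_value 0 1 (ae_class 0 1 ?W) 0 = ?W 0"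
      "point_value (-1) 0 (ae_class (-1) 0 ?U') 0 = ?U' 0" "point_value 0 1 (ae_class 0 1 ?W') 0 = ?W' 0"
      by (rule point_value_ae_class, rule cont, simp, simp)+
    moreover have "point_value (-1) 0 (weak_deriv (-1) 0 u) (-1) = 0" "point_value 0 1 w 1 = 0"
      "point_value (-1) 0 v 0 = point_value 0 1 w 0"
      "point_value (-1) 0 (weak_deriv (-1) 0 u) 0 = point_value 0 1 (weak_deriv 0 1 w) 0"
      using x by (simp_all add: A_dom_def)
    ultimately show "?U' (-1) = 0" "?W 1 = 0" "?V 0 = ?W 0" "?U' 0 = ?W' 0"
      unfolding u' w' unfolding v w by metis+
  qed
  \<comment> \<open>The mode satisfies the same conditions; subtracting leaves conditions on the homogeneous part.\<close>
  have bM: "exp_pair l (l * cu) (- l * du) (-1) = 0" "exp_pair m cw dw 1 = 0"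
    "exp_pair l (l * cu) (l * du) 0 = exp_pair m cw dw 0" "exp_pair l (l * cu) (- l * du) 0 = exp_pair m (m * cw) (- m * dw) 0"
    using M unfolding mode A_dom_def by (simp_all add: smooth_exp_pair point_value_ae_class continuous_exp_pair)
  have b: "exp_pair z (z * c) (- z * d) (-1) = 0" "exp_pair n p q 1 = 0"
    "z * exp_pair z c d 0 = exp_pair n p q 0" "exp_pair z (z * c) (- z * d) 0 = exp_pair n (n * p) (- n * q) 0"
    using bx bM by (simp_all add: exp_pair_scale)
  \<comment> \<open>The outer boundary conditions reduce the homogeneous part to \<open>2 k cosh (z (x + 1))\<close> and \<open>2 j sinh (n (1 - x))\<close>.\<close>
  define k where "k = c * exp (- z)"
  define j where "j = q * exp (- n)"
  have ce: "c = k * exp z" by (simp add: k_def exp_minus field_simps)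
  have de: "d = k * exp (- z)"
    using b(1) \<open>z \<noteq> 0\<close> by (simp add: exp_pair_def k_def exp_minus field_simps)
  have qe: "q = j * exp n" by (simp add: j_def exp_minus field_simps)
  have pe: "p = - (j * exp (- n))"
  proof -
    have "p * exp n = - q * exp (- n)" using b(2) by (simp add: exp_pair_def eq_neg_iff_add_eq_0)
    then show ?thesis by (simp add: j_def exp_minus field_simps)
  qed
  have e: "exp z = cosh z + sinh z" "exp (- z) = cosh z - sinh z" "exp n = cosh n + sinh n" "exp (- n) = cosh n - sinh n"
    by (simp_all add: cosh_plus_sinh cosh_minus_sinh)
  have "z * (k * exp z + k * exp (- z)) = - (j * exp (- n)) + j * exp n"
    "z * (k * exp z) - z * (k * exp (- z)) = - (n * (j * exp (- n))) - n * (j * exp n)"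
    using b(3,4) unfolding ce de pe qe by (simp_all add: exp_pair_def)
  then have r1: "z * k * cosh z = j * sinh n" and r2: "z * k * sinh z = - (j * n * cosh n)"
    unfolding e by algebra+
  have "z * k * (n * cosh n * cosh z + sinh n * sinh z) = 0"
  proof -
    have "z * k * (n * cosh n * cosh z + sinh n * sinh z) = n * cosh n * (z * k * cosh z) + sinh n * (z * k * sinh z)"
      by (simp add: algebra_simps)
    also have "\<dots> = 0" unfolding r1 r2 by (simp add: algebra_simps)
    finally show ?thesis .
  qed
  then have k: "k = 0" using nd \<open>z \<noteq> 0\<close> by simp
  have j: "j = 0"
  proof (rule ccontr)
    assume "j \<noteq> 0"
    then have "sinh n = 0" "cosh n = 0" using r1 r2 k \<open>n \<noteq> 0\<close> by auto
    then show False using cosh_square_eq[of n] by simp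
  qed
  have "exp_pair z c d = (\<lambda>_. 0)" "exp_pair n p q = (\<lambda>_. 0)"
    by (auto simp: ce de pe qe k j exp_pair_def)
  then show ?thesis
    unfolding xe mode u v w by (simp add: exp_pair_scale[abs_def, symmetric] fun_eq_iff)
qed

section \<open>Roots of the characteristic equation\<close>

lemma norm_sinh_le_cosh_Re: "norm (sinh z) \<le> cosh (Re z)" for z :: complex
proof -
  have "norm (sinh z) = norm (exp z - exp (- z)) / 2"
    by (simp add: sinh_field_def norm_divide)
  also have "\<dots> \<le> (norm (exp z) + norm (exp (- z))) / 2"
    by (intro divide_right_mono norm_triangle_ineq4) simp
  also have "\<dots> = cosh (Re z)" by (simp add: cosh_field_def)
  finally show ?thesis .
qed

lemma sinh_Re_le_norm_cosh: "sinh (Re z) \<le> norm (cosh z)" for z :: complex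
proof -
  have "norm (exp z) - norm (exp (- z)) \<le> norm (exp z + exp (- z))"
    by (rule norm_diff_ineq)
  then show ?thesis by (simp add: cosh_field_def sinh_field_def norm_divide)
qed

lemma sinh_Re_le_norm_sinh: "sinh (Re z) \<le> norm (sinh z)" for z :: complex
proof -
  have "norm (exp z) - norm (exp (- z)) \<le> norm (exp z - exp (- z))"
    by (rule norm_triangle_ineq2)
  then show ?thesis by (simp add: cosh_field_def sinh_field_def norm_divide)
qed

lemma cosh_le_2_sinh: "cosh x \<le> 2 * sinh x" if "x \<ge> 1" for x :: real
proof -
  have "2 \<le> exp x" using exp_ge_add_one_self[of x] that by linarith
  then have "4 \<le> exp x * exp x" using mult_mono[of 2 "exp x" 2 "exp x"] by simp
  then have "3 * exp (- x) \<le> exp x" by (simp add: exp_minus field_simps)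
  then show ?thesis by (simp add: cosh_field_def sinh_field_def)
qed

lemma cosh_imaginary: "cosh (\<i> * complex_of_real s) = of_real (cos s)"
  using cos_conv_cosh[of "complex_of_real s"] by (simp add: cos_of_real)

lemma sinh_imaginary: "sinh (\<i> * complex_of_real s) = \<i> * of_real (sin s)"
  using sin_conv_sinh[of "complex_of_real s"] by (simp add: sin_of_real)

text \<open>Here \<open>m = p + i q\<close> is a square root of a number near the imaginary axis, so \<open>\<bar>q\<bar>\<close> is close to \<open>p\<close>.
The modulus of \<open>tanh m\<close> is at most \<open>cosh p / sinh p\<close>. The sign of the real part of
\<open>tanh m / m\<close> is that of \<open>p sinh (2 p) + q sin (2 q)\<close>, in which the first term dominates. This
positivity is used twice: it excludes large zeros of the characteristic function on the imaginary axis, and it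
puts the eigenvalues into the left half-plane.\<close>

lemma tanh_quotient_bounds:
  fixes m :: complex
  assumes p: "Re m \<ge> 1" and z: "\<bar>Re (m\<^sup>2)\<bar> \<le> 1"
  shows "cosh m \<noteq> 0" "norm (sinh m / (m * cosh m)) \<le> 2 / norm m" "Re (sinh m / (m * cosh m)) > 0"
proof -
  define p q where "p = Re m" and "q = Im m"
  have "p \<ge> 1" using p by (simp add: p_def)
  have spos: "sinh p > 0" using \<open>p \<ge> 1\<close> by simp
  have c: "norm (cosh m) > 0" using sinh_Re_le_norm_cosh[of m] spos unfolding p_def by linarith
  then show nz: "cosh m \<noteq> 0" by simp
  have "m \<noteq> 0" using \<open>p \<ge> 1\<close> p_def by auto
  have "norm (sinh m) \<le> 2 * norm (cosh m)"
    using norm_sinh_le_cosh_Re[of m] sinh_Re_le_norm_cosh[of m] cosh_le_2_sinh[OF p] by linarith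
  then have "norm (sinh m) / norm (cosh m) \<le> 2" using c by (simp add: field_simps)
  then have "norm (sinh m) / norm (cosh m) / norm m \<le> 2 / norm m" by (rule divide_right_mono) simp
  then show "norm (sinh m / (m * cosh m)) \<le> 2 / norm m" by (simp add: norm_divide norm_mult mult.commute)
  \<comment> \<open>The real part has the sign of that of \<open>sinh m\<close> times the conjugate of \<open>m cosh m\<close>.\<close>
  have "\<bar>p\<^sup>2 - q\<^sup>2\<bar> \<le> 1" using z by (simp add: p_def q_def power2_eq_square complex_eq_iff)
  then have "q\<^sup>2 \<le> p\<^sup>2 + 1" by linarith
  also have "\<dots> < (2 * p)\<^sup>2" using mult_mono[of 1 p 1 p] \<open>p \<ge> 1\<close> by (simp add: power2_eq_square)
  finally have "\<bar>q\<bar>\<^sup>2 < (2 * p)\<^sup>2" by simp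
  then have q: "\<bar>q\<bar> < 2 * p" by (rule power2_less_imp_less) (use \<open>p \<ge> 1\<close> in simp)
  have sc: "sinh m = Complex (sinh p * cos q) (cosh p * sin q)" "cosh m = Complex (cosh p * cos q) (sinh p * sin q)"
    by (simp_all add: complex_eq_iff sinh_field_def cosh_field_def Re_exp Im_exp p_def q_def field_simps)
  have sc2: "(sin q)\<^sup>2 + (cos q)\<^sup>2 = 1" by simp
  have ch2: "(cosh p)\<^sup>2 = (sinh p)\<^sup>2 + 1" by (rule cosh_square_eq)
  have "Re (sinh m * cnj (m * cosh m)) =
      p * (sinh p * cosh p) * ((sin q)\<^sup>2 + (cos q)\<^sup>2) + q * (sin q * cos q) * ((cosh p)\<^sup>2 - (sinh p)\<^sup>2)"
    unfolding sc by (simp only: complex_cnj_mult complex_cnj times_complex.sel complex.sel cnj.sel p_def[symmetric] q_def[symmetric]) algebra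
  also have "\<dots> = p * (sinh p * cosh p) + q * (sin q * cos q)"
    unfolding sc2 ch2 by simp
  also have "\<dots> > 0"
  proof -
    have "1 \<le> sinh p"
      using real_le_x_sinh[of p] \<open>p \<ge> 1\<close> by (simp add: sinh_field_def exp_minus)
    moreover have "1 \<le> cosh p" by (rule cosh_real_ge_1)
    ultimately have "p * (1 * 1) \<le> p * (sinh p * cosh p)"
      using \<open>p \<ge> 1\<close> by (intro mult_left_mono mult_mono) auto
    moreover have "\<bar>q * (sin q * cos q)\<bar> \<le> \<bar>q\<bar> / 2"
    proof -
      have "\<bar>sin (2 * q)\<bar> \<le> 1" by simp
      then have "\<bar>sin q * cos q\<bar> \<le> 1/2" by (simp add: sin_double abs_mult)
      then have "\<bar>q\<bar> * \<bar>sin q * cos q\<bar> \<le> \<bar>q\<bar> * (1/2)" by (rule mult_left_mono) simp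
      then show ?thesis by (simp add: abs_mult)
    qed
    ultimately show ?thesis using q by linarith
  qed
  finally have "Re (sinh m * cnj (m * cosh m)) > 0" .
  then show "Re (sinh m / (m * cosh m)) > 0"
    using \<open>m \<noteq> 0\<close> nz by (subst complex_div_cnj) (simp add: Re_divide_of_real zero_less_divide_iff del: complex_cnj_mult)
qed

lemma csqrt_Re_ge_1:
  assumes "\<bar>Re z\<bar> \<le> 1" "\<bar>Im z\<bar> \<ge> 3"
  shows "Re (csqrt z) \<ge> 1"
proof (rule ccontr)
  assume neg: "\<not> 1 \<le> Re (csqrt z)"
  define p q where "p = Re (csqrt z)" and "q = Im (csqrt z)"
  have p: "0 \<le> p" "p < 1" using neg csqrt_principal[of z] by (auto simp: p_def)
  have "csqrt z = Complex p q" by (simp only: p_def q_def complex.collapse)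
  then have "z = (Complex p q)\<^sup>2" using power2_csqrt[of z] by simp
  then have z: "Re z = p\<^sup>2 - q\<^sup>2" "Im z = 2 * p * q"
    by (simp_all add: power2_eq_square)
  have "p\<^sup>2 \<le> 1" using p by (simp add: power_le_one)
  moreover have "q\<^sup>2 \<le> p\<^sup>2 + 1" using assms(1) z(1) by linarith
  ultimately have "p\<^sup>2 * q\<^sup>2 \<le> 1 * 2" by (intro mult_mono) auto
  then have "(Im z)\<^sup>2 \<le> 8" unfolding z by (simp add: power_mult_distrib)
  moreover have "3\<^sup>2 \<le> (\<bar>Im z\<bar>)\<^sup>2" using assms(2) by (intro power_mono) auto
  ultimately show False by simp
qed

text \<open>A zero \<open>is\<close> would give \<open>cos s + i (tanh m / m) sin s = 0\<close>. The imaginary part is the product of \<open>sin s\<close>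
with a positive number, so \<open>sin s\<close> and then \<open>cos s\<close> would vanish.\<close>

lemma characteristic_nonzero_imaginary_axis:
  assumes "\<bar>s\<bar> \<ge> 3"
  defines "m \<equiv> csqrt (\<i> * of_real s)"
  shows "m * cosh m * cosh (\<i> * of_real s) + sinh m * sinh (\<i> * of_real s) \<noteq> 0"
proof
  assume eq: "m * cosh m * cosh (\<i> * of_real s) + sinh m * sinh (\<i> * of_real s) = 0"
  have p: "Re m \<ge> 1" unfolding m_def using assms by (intro csqrt_Re_ge_1) auto
  have z: "\<bar>Re (m\<^sup>2)\<bar> \<le> 1" unfolding m_def by simp
  note b = tanh_quotient_bounds[OF p z]
  have "m \<noteq> 0" using p by auto
  define g where "g = sinh m / (m * cosh m)"
  have g: "sinh m = g * (m * cosh m)" using b(1) \<open>m \<noteq> 0\<close> by (simp add: g_def)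
  have "cosh (\<i> * of_real s) + g * sinh (\<i> * of_real s) = 0"
  proof -
    have "m * cosh m * (cosh (\<i> * of_real s) + g * sinh (\<i> * of_real s)) = 0"
      using eq unfolding g by (simp add: algebra_simps)
    then show ?thesis using b(1) \<open>m \<noteq> 0\<close> by simp
  qed
  then have e: "of_real (cos s) + g * (\<i> * of_real (sin s)) = 0"
    by (simp add: cosh_imaginary sinh_imaginary)
  then have "Re g * sin s = 0" by (simp add: complex_eq_iff)
  moreover have "Re g > 0" using b(3) by (simp add: g_def)
  ultimately have "sin s = 0" by simp
  then have "cos s = 0" using e by (simp add: complex_eq_iff)
  with \<open>sin s = 0\<close> sin_cos_squared_add[of s] show False by simp
qed

text \<open>At \<open>l = i t + d\<close> with \<open>cos t = 0\<close> the characteristic equation reads \<open>tanh d = - g\<close> with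
\<open>g = tanh m / m\<close> and \<open>m\<^sup>2 = l\<close>. It is solved as the fixed point equation \<open>d = - artanh g\<close> on the
closed unit disc by Brouwer's theorem, because \<open>g\<close> has modulus at most \<open>2 / sqrt (t - 1)\<close>. The
same bound estimates \<open>d\<close>, and \<open>Re g > 0\<close> yields \<open>\<bar>exp (2 d)\<bar> = \<bar>1 - g\<bar> / \<bar>1 + g\<bar> < 1\<close>, that is
\<open>Re d < 0\<close>. The lower bound on \<open>n\<close> makes \<open>t \<ge> 18\<close>, so that \<open>\<bar>g\<bar> < 1/2\<close> and the
fixed point map preserves the disc.\<close>

lemma characteristic_root_exists:
  assumes n: "n \<ge> (6::nat)"
  defines "t \<equiv> (real n + 1/2) * pi"
  shows "\<exists>l m. m\<^sup>2 = l \<and> Re m \<ge> 1 \<and> m * cosh m * cosh l + sinh m * sinh l = 0 \<and>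
    Re l < 0 \<and> \<bar>Im l - t\<bar> \<le> 1 \<and> - (8 / sqrt \<bar>Im l\<bar>) \<le> Re l"
proof -
  have t: "t \<ge> 18"
  proof -
    have "6 * 3 \<le> (real n + 1/2) * pi" using n pi_gt3 by (intro mult_mono) auto
    then show ?thesis by (simp add: t_def)
  qed
  define z where "z = (\<lambda>d. \<i> * of_real t + d :: complex)"
  define g where "g = (\<lambda>d. sinh (csqrt (z d)) / (csqrt (z d) * cosh (csqrt (z d))))"
  \<comment> \<open>\<open>T d\<close> is \<open>- artanh (g d)\<close>.\<close>
  define T where "T = (\<lambda>d. - (Ln (1 + g d) - Ln (1 - g d)) / 2)"
  have d: "\<bar>Re d\<bar> \<le> 1 \<and> \<bar>Im d\<bar> \<le> 1" if "d \<in> cball 0 1" for d :: complex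
    using that abs_Re_le_cmod[of d] abs_Im_le_cmod[of d] by auto
  have zb: "\<bar>Re (z d)\<bar> \<le> 1" "Im (z d) \<ge> t - 1" "\<bar>Im (z d) - t\<bar> \<le> 1" if "d \<in> cball 0 1" for d
    using d[OF that] by (auto simp: z_def)
  have m1: "Re (csqrt (z d)) \<ge> 1" "\<bar>Re ((csqrt (z d))\<^sup>2)\<bar> \<le> 1" if "d \<in> cball 0 1" for d
    using csqrt_Re_ge_1[OF zb(1)[OF that]] zb[OF that] t by auto
  note gb = tanh_quotient_bounds[OF m1, folded g_def]
  have gn: "norm (g d) \<le> 2 / sqrt (t - 1)" if "d \<in> cball 0 1" for d
  proof -
    have "t - 1 \<le> norm (z d)" using zb(2)[OF that] abs_Im_le_cmod[of "z d"] by linarith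
    then have le: "sqrt (t - 1) \<le> norm (csqrt (z d))" by (simp add: norm_csqrt)
    moreover have pos: "sqrt (t - 1) > 0" using t by simp
    ultimately have "2 / norm (csqrt (z d)) \<le> 2 / sqrt (t - 1)"
      by (intro divide_left_mono mult_pos_pos) linarith+
    then show ?thesis using gb(2)[OF that that] unfolding g_def by linarith
  qed
  have s4: "sqrt (t - 1) > 4" using t by (intro real_less_rsqrt) simp
  have g2: "norm (g d) < 1/2" if "d \<in> cball 0 1" for d
  proof -
    have "2 / sqrt (t - 1) < 2 / 4" using s4 by (intro divide_strict_left_mono mult_pos_pos) linarith+
    with gn[OF that] show ?thesis by linarith
  qed
  have Tn: "norm (T d) \<le> 4 / sqrt (t - 1)" if "d \<in> cball 0 1" for d
  proof -
    have "norm (T d) = norm (Ln (1 + g d) - Ln (1 - g d)) / 2" by (simp add: T_def norm_divide norm_minus_commute)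
    also have "\<dots> \<le> (norm (Ln (1 + g d)) + norm (Ln (1 - g d))) / 2"
      by (intro divide_right_mono norm_triangle_ineq4) simp
    also have "\<dots> \<le> (2 * norm (g d) + 2 * norm (g d)) / 2"
      using norm_Ln_le[of "g d"] norm_Ln_le[of "- g d"] g2[OF that] by (intro divide_right_mono add_mono) auto
    also have "\<dots> \<le> 4 / sqrt (t - 1)" using gn[OF that] by simp
    finally show ?thesis .
  qed
  have nonneg: "1 + g d \<notin> \<real>\<^sub>\<le>\<^sub>0" "1 - g d \<notin> \<real>\<^sub>\<le>\<^sub>0" if "d \<in> cball 0 1" for d
  proof -
    have "\<bar>Re (g d)\<bar> \<le> 1/2" using g2[OF that] abs_Re_le_cmod[of "g d"] by linarith
    then show "1 + g d \<notin> \<real>\<^sub>\<le>\<^sub>0" "1 - g d \<notin> \<real>\<^sub>\<le>\<^sub>0" by (auto simp: complex_nonpos_Reals_iff)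
  qed
  have zc: "z d \<notin> \<real>\<^sub>\<le>\<^sub>0" if "d \<in> cball 0 1" for d
    using zb(2)[OF that] t by (auto simp: complex_nonpos_Reals_iff)
  have cz: "continuous_on (cball 0 1) (\<lambda>d. csqrt (z d))"
  proof (rule continuous_on_compose2[OF continuous_on_csqrt])
    show "continuous_on (cball 0 1) z" unfolding z_def by (intro continuous_intros)
    show "z ` cball 0 1 \<subseteq> - \<real>\<^sub>\<le>\<^sub>0" using zc by blast
  qed
  have ne: "csqrt (z d) \<noteq> 0" if "d \<in> cball 0 1" for d using m1(1)[OF that] by auto
  have cg: "continuous_on (cball 0 1) g"
    unfolding g_def using gb(1) ne by (intro continuous_intros cz) auto
  have cT: "continuous_on (cball 0 1) T"
    unfolding T_def using nonneg by (intro continuous_intros cg) auto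
  have "T ` cball 0 1 \<subseteq> cball 0 1"
  proof clarify
    fix d :: complex assume "d \<in> cball 0 1"
    moreover have "4 / sqrt (t - 1) \<le> 4 / 4" using s4 by (intro divide_left_mono mult_pos_pos) linarith+
    ultimately show "T d \<in> cball 0 1" using Tn[of d] by simp
  qed
  then have Tm: "T \<in> cball 0 1 \<rightarrow> cball 0 1" by blast
  obtain \<delta> where \<delta>: "\<delta> \<in> cball 0 1" "T \<delta> = \<delta>"
    using brouwer[OF compact_cball convex_cball _ cT Tm] by auto
  define l m where "l = z \<delta>" and "m = csqrt l"
  have gp: "Re (g \<delta>) > 0" using gb(3)[OF \<delta>(1) \<delta>(1)] by (simp add: g_def)
  have n0: "1 + g \<delta> \<noteq> 0" "1 - g \<delta> \<noteq> 0" using nonneg[OF \<delta>(1)] by auto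
  have ex: "exp (2 * \<delta>) = (1 - g \<delta>) / (1 + g \<delta>)"
  proof -
    have "2 * \<delta> = Ln (1 - g \<delta>) - Ln (1 + g \<delta>)" using \<delta>(2) by (simp add: T_def)
    then show ?thesis using n0 by (simp add: exp_diff)
  qed
  have "exp (2 * \<delta>) = exp \<delta> * exp \<delta>" by (simp only: mult_2 exp_add)
  then have "exp \<delta> * exp \<delta> * (1 + g \<delta>) = 1 - g \<delta>"
    using ex n0(1) by (metis nonzero_eq_divide_eq)
  moreover have "exp \<delta> * exp (- \<delta>) = 1" by (simp add: exp_add[symmetric])
  ultimately have "exp \<delta> - exp (- \<delta>) = - g \<delta> * (exp \<delta> + exp (- \<delta>))" by algebra
  then have sinh\<delta>: "sinh \<delta> = - g \<delta> * cosh \<delta>"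
    by (simp add: sinh_field_def cosh_field_def)
  have ct: "cos t = 0"
  proof -
    have "cos t = cos (real n * pi + pi / 2)" by (simp add: t_def algebra_simps)
    then show ?thesis by (simp add: cos_add)
  qed
  have "cosh (\<i> * complex_of_real t) = 0" "sinh (\<i> * complex_of_real t) = \<i> * of_real (sin t)"
    using ct by (simp_all add: cosh_imaginary sinh_imaginary)
  then have "cosh l = \<i> * of_real (sin t) * sinh \<delta>" "sinh l = \<i> * of_real (sin t) * cosh \<delta>"
    by (simp_all add: l_def z_def cosh_add sinh_add)
  then have "cosh l = - g \<delta> * sinh l" using sinh\<delta> by simp
  moreover have "g \<delta> * (m * cosh m) = sinh m"
    using gb(1)[OF \<delta>(1) \<delta>(1)] ne[OF \<delta>(1)] by (simp add: g_def m_def l_def)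
  ultimately have "m * cosh m * cosh l + sinh m * sinh l = 0" by algebra
  moreover have "m\<^sup>2 = l" by (simp add: m_def)
  moreover have "Re m \<ge> 1" using m1(1)[OF \<delta>(1)] by (simp add: m_def l_def)
  moreover have "\<bar>Im l - t\<bar> \<le> 1" using zb(3)[OF \<delta>(1)] by (simp add: l_def)
  moreover have Rel: "Re l = Re \<delta>" by (simp add: l_def z_def)
  moreover have "Re \<delta> < 0"
  proof -
    have "(norm (1 - g \<delta>))\<^sup>2 < (norm (1 + g \<delta>))\<^sup>2"
      using gp by (simp add: cmod_power2) (simp add: power2_eq_square algebra_simps)
    then have "norm (1 - g \<delta>) < norm (1 + g \<delta>)" by (rule power2_less_imp_less) simp
    moreover have "norm (1 + g \<delta>) > 0" using n0 by simp
    ultimately have "norm (exp (2 * \<delta>)) < 1" unfolding ex by (simp add: norm_divide)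
    then show ?thesis by simp
  qed
  moreover have "- (8 / sqrt \<bar>Im l\<bar>) \<le> Re l"
  proof -
    have Im: "0 < Im l" "Im l \<le> t + 1" using zb(2,3)[OF \<delta>(1)] t by (auto simp: l_def)
    have "sqrt \<bar>Im l\<bar> \<le> sqrt (2\<^sup>2 * (t - 1))" using Im t by (intro real_sqrt_le_mono) auto
    also have "\<dots> = 2 * sqrt (t - 1)" unfolding real_sqrt_mult by simp
    finally have "8 / (2 * sqrt (t - 1)) \<le> 8 / sqrt \<bar>Im l\<bar>" using Im t by (intro divide_left_mono) auto
    moreover have "\<bar>Re \<delta>\<bar> \<le> 4 / sqrt (t - 1)"
      using Tn[OF \<delta>(1)] \<delta>(2) abs_Re_le_cmod[of \<delta>] by simp
    ultimately show ?thesis unfolding Rel by simp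
  qed
  ultimately show ?thesis by auto
qed

section \<open>Spectrum and resolvent\<close>

text \<open>The characteristic equation is invariant under \<open>m \<mapsto> - m\<close>. The square root with real part at least 1 is
singled out because there \<open>sinh m\<close> does not vanish.\<close>

definition characteristic_root :: "complex \<Rightarrow> bool" where
  "characteristic_root l \<longleftrightarrow>
     (\<exists>m. m\<^sup>2 = l \<and> Re m \<ge> 1 \<and> m * cosh m * cosh l + sinh m * sinh l = 0)"

lemma characteristic_root_cnj:
  assumes "characteristic_root l" shows "characteristic_root (cnj l)"
proof -
  have cc: "cosh (cnj z) = cnj (cosh z)" and ss: "sinh (cnj z) = cnj (sinh z)" for z
    by (simp_all add: cosh_field_def sinh_field_def exp_cnj flip: complex_cnj_minus)
  obtain m where m: "m\<^sup>2 = l" "Re m \<ge> 1" "m * cosh m * cosh l + sinh m * sinh l = 0"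
    using assms by (auto simp: characteristic_root_def)
  have "(cnj m)\<^sup>2 = cnj l" using m(1) by (simp flip: complex_cnj_power)
  moreover have "cnj m * cosh (cnj m) * cosh (cnj l) + sinh (cnj m) * sinh (cnj l) = cnj (m * cosh m * cosh l + sinh m * sinh l)"
    by (simp add: cc ss)
  ultimately show ?thesis
    unfolding characteristic_root_def using m by (intro exI[of _ "cnj m"]) simp
qed

text \<open>The interface conditions form a homogeneous linear system for \<open>\<alpha>\<close> and \<open>\<gamma>\<close>, singular at a root, with
solution \<open>\<alpha> = sinh m\<close>, \<open>\<gamma> = l cosh l\<close>. The scaling factor \<open>k\<close> provides both the zero state
and normalised eigenvectors.\<close>

lemma characteristic_root_eigenmode:
  assumes "characteristic_root l"
  obtains m \<alpha> \<gamma> where "l = m\<^sup>2" "\<alpha> \<noteq> 0" "\<And>k. mode l m (k * \<alpha>) (k * \<gamma>) \<in> A_dom"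
proof -
  obtain m where m: "m\<^sup>2 = l" "Re m \<ge> 1" "m * cosh m * cosh l + sinh m * sinh l = 0"
    using assms by (auto simp: characteristic_root_def)
  have "sinh (Re m) > 0" using m(2) by simp
  then have "sinh m \<noteq> 0" using sinh_Re_le_norm_sinh[of m] by auto
  moreover have "mode l m (k * sinh m) (k * (l * cosh l)) \<in> A_dom" for k
  proof (rule mode_in_A_dom)
    have "sinh m * sinh l = - (m * cosh m * cosh l)" using m(3) by (simp add: eq_neg_iff_add_eq_0 add.commute)
    then show "k * sinh m * l * sinh l = - (k * (l * cosh l) * m * cosh m)" by algebra
  qed (simp add: mult_ac)
  ultimately show ?thesis using that m(1) by blast
qed

lemma characteristic_root_in_spectrum:
  assumes "characteristic_root l" shows "l \<in> spectrum_A"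
proof -
  obtain m \<alpha> \<gamma> where m: "l = m\<^sup>2" "\<alpha> \<noteq> 0" "\<And>k. mode l m (k * \<alpha>) (k * \<gamma>) \<in> A_dom"
    using characteristic_root_eigenmode[OF assms] by metis
  have "mode l m \<alpha> \<gamma> \<in> A_dom" "mode l m 0 0 \<in> A_dom" using m(3)[of 1] m(3)[of 0] by simp_all
  moreover have "z_minus_A l (mode l m \<alpha> \<gamma>) = z_minus_A l (mode l m 0 0)"
    by (simp add: z_minus_A_mode[OF m(1)])
  moreover have "mode l m \<alpha> \<gamma> \<noteq> mode l m 0 0"
    using X_norm_mode_scale[of l m 0 \<alpha> \<gamma>] X_norm_mode_pos[OF m(2), of l m \<gamma>] by auto
  ultimately have "\<not> inj_on (z_minus_A l) A_dom" by (meson inj_onD)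
  then show ?thesis by (simp add: spectrum_A_def resolvent_set_def bij_betw_def)
qed

text \<open>An eigenvector \<open>x\<close> for \<open>l\<close> satisfies \<open>(z - A) x = (z - l) x = - (Re l) x\<close> at the point \<open>z\<close> of the imaginary axis
with the imaginary part of \<open>l\<close>. So the resolvent maps \<open>- (Re l) x\<close> to \<open>x\<close>, once
\<open>x\<close> is known to be the only preimage, and its norm is at least \<open>1 / \<bar>Re l\<bar>\<close>.\<close>

lemma resolvent_norm_ge:
  assumes l: "characteristic_root l" and im: "\<bar>Im l\<bar> \<ge> 3" and re: "Re l \<noteq> 0"
  shows "ereal (1 / \<bar>Re l\<bar>) \<le> resolvent_norm (\<i> * of_real (Im l))"
proof -
  define z where "z = \<i> * complex_of_real (Im l)"
  obtain m \<alpha> \<gamma> where m: "l = m\<^sup>2" "\<alpha> \<noteq> 0" "\<And>k. mode l m (k * \<alpha>) (k * \<gamma>) \<in> A_dom"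
    using characteristic_root_eigenmode[OF l] by metis
  define N where "N = X_norm (mode l m \<alpha> \<gamma>)"
  have "N > 0" unfolding N_def by (rule X_norm_mode_pos[OF m(2)])
  \<comment> \<open>The scaling gives the image \<open>(z - A) x\<close> norm 1.\<close>
  define k where "k = complex_of_real (1 / (\<bar>Re l\<bar> * N))"
  define x where "x = mode l m (k * \<alpha>) (k * \<gamma>)"
  have x: "x \<in> A_dom" unfolding x_def by (rule m(3))
  have "z - l = - of_real (Re l)" by (simp add: z_def complex_eq_iff)
  then have y: "z_minus_A z x = mode l m ((- of_real (Re l) * k) * \<alpha>) ((- of_real (Re l) * k) * \<gamma>)"
    unfolding x_def z_minus_A_mode[OF m(1)] by (simp add: mult.assoc)
  have "norm k = 1 / (\<bar>Re l\<bar> * N)" using \<open>N > 0\<close> by (simp add: k_def norm_divide norm_mult)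
  then have yn: "X_norm (z_minus_A z x) = 1" and xn: "X_norm x = 1 / \<bar>Re l\<bar>"
    using \<open>N > 0\<close> re unfolding y unfolding x_def X_norm_mode_scale N_def[symmetric] by (simp_all add: norm_mult)
  have yX: "z_minus_A z x \<in> X_space" unfolding y by (rule mode_in_X_space)
  have "resolvent z (z_minus_A z x) = x"
    unfolding x_def
  proof (rule preimage_of_mode_unique[OF _ _ m(1), where z = z and n = "csqrt z"])
    show "resolvent z (z_minus_A z (mode l m (k * \<alpha>) (k * \<gamma>))) \<in> A_dom"
      unfolding resolvent_def by (rule inv_into_into) (use m(3) in blast)
    show "z_minus_A z (resolvent z (z_minus_A z (mode l m (k * \<alpha>) (k * \<gamma>)))) = z_minus_A z (mode l m (k * \<alpha>) (k * \<gamma>))"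
      unfolding resolvent_def by (rule f_inv_into_f) (use m(3) in blast)
    show "csqrt z * cosh (csqrt z) * cosh z + sinh (csqrt z) * sinh z \<noteq> 0"
      unfolding z_def by (rule characteristic_nonzero_imaginary_axis[OF im])
  qed (use m(3) im in \<open>auto simp: z_def\<close>)
  then have "ereal (1 / \<bar>Re l\<bar>) = ereal (X_norm (resolvent z (z_minus_A z x)))" using xn by simp
  also have "\<dots> \<le> resolvent_norm z"
    unfolding resolvent_norm_def by (rule SUP_upper) (use yX yn in simp)
  finally show ?thesis by (simp add: z_def)
qed

theorem theorem3p4:
  shows "(\<exists>(lp :: nat \<Rightarrow> complex) (lm :: nat \<Rightarrow> complex) (C :: real).
            C > 0 \<and>
            (\<forall>n. lp n \<in> spectrum_A \<and> lm n \<in> spectrum_A) \<and>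
            (\<lambda>n. Im (lp n)) \<sim>[sequentially] (\<lambda>n. real n * pi) \<and>
            (\<lambda>n. Im (lm n)) \<sim>[sequentially] (\<lambda>n. - (real n * pi)) \<and>
            (\<forall>n. - (C / \<bar>Im (lp n)\<bar> powr (1/2)) \<le> Re (lp n) \<and> Re (lp n) < 0) \<and>
            (\<forall>n. - (C / \<bar>Im (lm n)\<bar> powr (1/2)) \<le> Re (lm n) \<and> Re (lm n) < 0))
         \<and> Limsup at_infinity
             (\<lambda>s::real. ereal (\<bar>s\<bar> powr (-1/2)) * resolvent_norm (\<i> * of_real s)) > 0"
proof -
  \<comment> \<open>\<open>13/2 = 6 + 1/2\<close>: roots exist from index 6 on, and a shift of the index does not affect the asymptotics.\<close>
  have "\<exists>l. characteristic_root l \<and> Re l < 0 \<and> \<bar>Im l - (real n + 13/2) * pi\<bar> \<le> 1 \<and> - (8 / sqrt \<bar>Im l\<bar>) \<le> Re l" for n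
    using characteristic_root_exists[of "n + 6"] unfolding characteristic_root_def by (fastforce simp: add_ac)
  then obtain l where root: "\<And>n. characteristic_root (l n)" and neg: "\<And>n. Re (l n) < 0"
    and im: "\<And>n. \<bar>Im (l n) - (real n + 13/2) * pi\<bar> \<le> 1" and re: "\<And>n. - (8 / sqrt \<bar>Im (l n)\<bar>) \<le> Re (l n)"
    by metis
  have im_ge: "Im (l n) \<ge> real n + 3" for n
  proof -
    define T where "T = (real n + 13/2) * pi"
    have "real n + 13/2 \<le> T"
      unfolding T_def using mult_left_mono[of 1 pi "real n + 13/2"] pi_ge_two by simp
    moreover have "\<bar>Im (l n) - T\<bar> \<le> 1" using im[of n] by (simp only: T_def)
    ultimately show ?thesis by linarith
  qed
  have lim: "filterlim (\<lambda>n. Im (l n)) at_top sequentially"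
    by (rule filterlim_at_top_mono[OF filterlim_real_sequentially]) (rule always_eventually, rule allI, rule order_trans[OF _ im_ge], simp)
  have asymp: "(\<lambda>n. Im (l n)) \<sim>[sequentially] (\<lambda>n. real n * pi)"
  proof (rule asymp_equivI')
    define K where "K = 13/2 * pi + 1"
    have K: "\<bar>Im (l n) - real n * pi\<bar> \<le> K" for n
    proof -
      have "(real n + 13/2) * pi = real n * pi + 13/2 * pi" by (rule distrib_right)
      then show ?thesis using im[of n] pi_gt_zero unfolding K_def by linarith
    qed
    have "(\<lambda>n. Im (l n) / (real n * pi) - 1) \<longlonglongrightarrow> 0"
    proof (rule Lim_null_comparison)
      show "\<forall>\<^sub>F n in sequentially. norm (Im (l n) / (real n * pi) - 1) \<le> K / pi * inverse (real n)"
        using eventually_gt_at_top[of 0]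
      proof eventually_elim
        case (elim n)
        have "Im (l n) / (real n * pi) - 1 = (Im (l n) - real n * pi) / (real n * pi)"
          using elim by (simp add: field_simps)
        then have "norm (Im (l n) / (real n * pi) - 1) = \<bar>Im (l n) - real n * pi\<bar> / (real n * pi)"
          by (simp add: abs_mult)
        also have "\<dots> \<le> K / (real n * pi)" by (rule divide_right_mono[OF K]) simp
        also have "\<dots> = K / pi * inverse (real n)" by (simp add: field_simps)
        finally show ?case .
      qed
      show "(\<lambda>n. K / pi * inverse (real n)) \<longlonglongrightarrow> 0"
        using tendsto_mult[OF tendsto_const lim_inverse_n] by simp
    qed
    then show "(\<lambda>n. Im (l n) / (real n * pi)) \<longlonglongrightarrow> 1" by (simp add: LIM_zero_iff)
  qed
  have resolvent: "ereal (1/8) \<le> ereal (\<bar>Im (l n)\<bar> powr (-1/2)) * resolvent_norm (\<i> * of_real (Im (l n)))" for n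
  proof -
    let ?s = "Im (l n)"
    have s: "?s > 0" "\<bar>?s\<bar> \<ge> 3" using im_ge[of n] by auto
    have "\<bar>Re (l n)\<bar> * sqrt ?s \<le> 8" using re[of n] neg[of n] s by (simp add: field_simps)
    then have "1 / 8 \<le> 1 / (\<bar>Re (l n)\<bar> * sqrt ?s)"
      using s neg[of n] by (intro divide_left_mono mult_pos_pos) auto
    also have "\<dots> = ?s powr (-1/2) * (1 / \<bar>Re (l n)\<bar>)"
    proof -
      have "?s powr (-1/2) = ?s powr (-(1/2))" by simp
      also have "\<dots> = 1 / ?s powr (1/2)" by (rule powr_minus_divide)
      also have "\<dots> = 1 / sqrt ?s" using s by (simp only: powr_half_sqrt less_imp_le)
      finally show ?thesis by simp
    qed
    finally have "ereal (1/8) \<le> ereal (\<bar>?s\<bar> powr (-1/2)) * ereal (1 / \<bar>Re (l n)\<bar>)" using s by simp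
    also have "\<dots> \<le> ereal (\<bar>?s\<bar> powr (-1/2)) * resolvent_norm (\<i> * of_real ?s)"
      using resolvent_norm_ge[OF root[of n] s(2)] neg[of n] by (intro ereal_mult_left_mono) auto
    finally show ?thesis .
  qed
  have "ereal (1/8) \<le> Limsup at_infinity (\<lambda>s::real. ereal (\<bar>s\<bar> powr (-1/2)) * resolvent_norm (\<i> * of_real s))"
    unfolding Limsup_def
  proof (rule INF_greatest)
    fix P :: "real \<Rightarrow> bool" assume "P \<in> {P. eventually P at_infinity}"
    then have "eventually P at_top" using at_top_le_at_infinity by (auto simp: le_filter_def)
    then have "eventually (\<lambda>n. P (Im (l n))) sequentially" using lim by (auto simp: filterlim_iff)
    then obtain n where "P (Im (l n))" by (auto simp: eventually_sequentially)
    then show "ereal (1/8) \<le> (SUP s\<in>Collect P. ereal (\<bar>s\<bar> powr (-1/2)) * resolvent_norm (\<i> * of_real s))"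
      using resolvent[of n] by (intro SUP_upper2) auto
  qed
  moreover have "(0::ereal) < ereal (1/8)" by simp
  ultimately have limsup: "0 < Limsup at_infinity (\<lambda>s::real. ereal (\<bar>s\<bar> powr (-1/2)) * resolvent_norm (\<i> * of_real s))"
    by (rule less_le_trans[rotated])
  have "- (8 / \<bar>Im (l n)\<bar> powr (1/2)) \<le> Re (l n)" for n
    using re[of n] by (simp add: powr_half_sqrt)
  moreover have "(\<lambda>n. Im (cnj (l n))) \<sim>[sequentially] (\<lambda>n. - (real n * pi))"
    using asymp_equiv_uminus[OF asymp] by simp
  ultimately show ?thesis
    using root neg asymp limsup characteristic_root_in_spectrum characteristic_root_cnj
    by (intro conjI exI[of _ l] exI[of _ "\<lambda>n. cnj (l n)"] exI[of _ 8]) auto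
qed

end
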